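(* Let $(A,\cdot)$ be an anti-Leibniz algebra and let $\Delta: A\to A\otimes A$ be a linear map such that $(A,\Delta)$ is an anti-Leibniz coalgebra; equip $A^{*}$ with the anti-Leibniz product $\xi_1\xi_2:=\Delta^{*}(\xi_1\otimes\xi_2)$. Then the following conditions are equivalent: (i) $(A, A^{*}, \mathbf{l}_{A}^{*}, \mathbf{l}_{A}^{*}-\mathbf{r}_{A}^{*}, \mathbf{l}_{A^{*}}^{*}, \mathbf{l}_{A^{*}}^{*}-\mathbf{r}_{A^{*}}^{*})$ is a matched pair of the anti-Leibniz algebras $(A,\cdot)$ and $(A^{*},\Delta^{*})$; (ii) $((A\oplus A^{*},\mathfrak{B}_d),A,A^{*})$ is a (standard) Manin triple of the anti-Leibniz algebras $(A,\cdot)$ and $(A^{*},\Delta^{*})$, i.e. there is an anti-Leibniz algebra structure on the vector space $A\oplus A^{*}$ making it such a Manin triple; (iii) $(A,\cdot,\Delta)$ is an anti-Leibniz bialgebra.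
   Context: $\Bbbk$ is a field of characteristic zero; all vector spaces and algebras are finite-dimensional over $\Bbbk$, and $\otimes=\otimes_\Bbbk$. $\tau(a\otimes b)=b\otimes a$. An anti-Leibniz algebra $(A,\cdot)$ is a vector space with a bilinear product $a\cdot b=ab$ such that $a_1(a_2a_3)+(a_1a_2)a_3+a_2(a_1a_3)=0$ for all $a_1,a_2,a_3\in A$. Put $\mathbf{l}_A(a)(b)=ab$, $\mathbf{r}_A(a)(b)=ba$. A bimodule over $(A,\cdot)$ is a vector space $M$ with linear maps $\mathfrak{l},\mathfrak{r}:A\to\mathfrak{gl}(M)$ satisfying, for all $a_1,a_2\in A$, $\mathfrak{l}(a_1a_2)+\mathfrak{l}(a_1)\mathfrak{l}(a_2)+\mathfrak{l}(a_2)\mathfrak{l}(a_1)=0$, $\mathfrak{l}(a_1)\mathfrak{r}(a_2)+\mathfrak{r}(a_2)\mathfrak{l}(a_1)+\mathfrak{r}(a_1a_2)=0$, $\mathfrak{r}(a_1a_2)+\mathfrak{r}(a_2)\mathfrak{r}(a_1)+\mathfrak{l}(a_1)\mathfrak{r}(a_2)=0$. For a linear map $\psi:A\to\mathfrak{gl}(V)$, $\psi^{*}:A\to\mathfrak{gl}(V^{*})$ is $\langle\psi^{*}(a)(\xi),v\rangle=\langle\xi,\psi(a)(v)\rangle$ (no sign). $A^{**}$ is identified with $A$, so e.g. $\mathbf{l}_{A^*}^*:A^*\to\mathfrak{gl}(A)$. Matched pair: given anti-Leibniz algebras $A,B$, a bimodule $(B,\mathfrak{l}_A,\mathfrak{r}_A)$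 over $A$ and a bimodule $(A,\mathfrak{l}_B,\mathfrak{r}_B)$ over $B$, $(A,B,\mathfrak{l}_A,\mathfrak{r}_A,\mathfrak{l}_B,\mathfrak{r}_B)$ is a matched pair if for all $a,a_1,a_2\in A$, $b,b_1,b_2\in B$: (1) $\mathfrak{r}_A(a)(b_1b_2)+b_1\mathfrak{r}_A(a)(b_2)+b_2\mathfrak{r}_A(a)(b_1)+\mathfrak{r}_A(\mathfrak{l}_B(b_2)(a))(b_1)+\mathfrak{r}_A(\mathfrak{l}_B(b_1)(a))(b_2)=0$; (2) $\mathfrak{l}_A(a)(b_1b_2)+\mathfrak{l}_A(a)(b_1)b_2+b_1\mathfrak{l}_A(a)(b_2)+\mathfrak{l}_A(\mathfrak{r}_B(b_1)(a))(b_2)+\mathfrak{r}_A(\mathfrak{r}_B(b_2)(a))(b_1)=0$; (3) $\mathfrak{l}_A(a)(b_1)b_2+\mathfrak{l}_A(\mathfrak{r}_B(b_1)(a))(b_2)-\mathfrak{r}_A(a)(b_1)b_2-\mathfrak{l}_A(\mathfrak{l}_B(b_1)(a))(b_2)=0$; (4)–(6) the three identities obtained from (1)–(3) by exchanging the roles of $A$ and $B$ (i.e. $\mathfrak{l}_A\leftrightarrow\mathfrak{l}_B$, $\mathfrak{r}_A\leftrightarrow\mathfrak{r}_B$, $a\leftrightarrow b$, $b_i\leftrightarrow a_i$). Anti-Leibniz coalgebra: a vector space $A$ with linear $\Delta:A\to A\otimes A$ satisfying $(\Delta\otimes\mathrm{id})\Delta+(\mathrm{id}\otimes\Delta)\Delta+(\tau\otimes\mathrm{id})(\mathrm{id}\otimes\Delta)\Delta=0$;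 equivalently $\Delta^*:A^*\otimes A^*\to A^*$, $\langle\Delta^*(\xi_1\otimes\xi_2),a\rangle=\langle\xi_1\otimes\xi_2,\Delta(a)\rangle$, is an anti-Leibniz product on $A^*$. (Standard) Manin triple: given anti-Leibniz structures on $A$ and $A^*$, an anti-Leibniz product on $A\oplus A^*$ having $A$ and $A^*$ as subalgebras and such that the bilinear form $\mathfrak{B}_d((a_1,\xi_1),(a_2,\xi_2))=\langle\xi_1,a_2\rangle-\langle\xi_2,a_1\rangle$ is invariant, where a bilinear form $\mathfrak{B}$ on an anti-Leibniz algebra is invariant if $\mathfrak{B}(xy,z)=\mathfrak{B}(x,yz-zy)$ for all $x,y,z$. Anti-Leibniz bialgebra: a triple $(A,\cdot,\Delta)$ with $(A,\cdot)$ an anti-Leibniz algebra, $(A,\Delta)$ an anti-Leibniz coalgebra, and for all $a_1,a_2\in A$: $\Delta(a_1a_2)+\big((\mathrm{id}\otimes\mathbf{r}_A(a_2)-\mathbf{r}_A(a_2)\otimes\mathrm{id}+\mathbf{l}_A(a_2)\otimes\mathrm{id})(\mathrm{id}\otimes\mathrm{id}-\tau)\big)\Delta(a_1)+(\mathrm{id}\otimes\mathbf{l}_A(a_1)+\mathbf{l}_A(a_1)\otimes\mathrm{id})\Delta(a_2)=0$, $(\mathbf{r}_A(a_1)\otimes\mathrm{id})\Delta(a_2)-\tau\big((\mathbf{r}_A(a_2)\otimes\mathrm{id})\Delta(a_1)\big)=0$. *)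

theory Defs
  imports Complex_Main "HOL-Library.Function_Algebras" "HOL-Library.Product_Plus"
begin

section \<open>Linear algebra on subspaces of an ambient type\<close>

text \<open>
  A vector space is a subspace \<open>V\<close> of an ambient vector space given by a scalar multiplication
  on a type. This is needed because the dual space depends on the scalar multiplication and is
  therefore a set of functions, not a type. Outside the carrier the values of maps are irrelevant.
\<close>

definition subspace_of :: "('k::field \<Rightarrow> 'v::ab_group_add \<Rightarrow> 'v) \<Rightarrow> 'v set \<Rightarrow> bool" where
  "subspace_of s V \<longleftrightarrow> vector_space s \<and> module.subspace s V"

definition linear_on ::
  "('k::field \<Rightarrow> 'v::ab_group_add \<Rightarrow> 'v) \<Rightarrow> 'v set \<Rightarrow> ('k \<Rightarrow> 'w::ab_group_add \<Rightarrow> 'w) \<Rightarrow> 'w set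
    \<Rightarrow> ('v \<Rightarrow> 'w) \<Rightarrow> bool" where
  "linear_on sV V sW W f \<longleftrightarrow>
     (\<forall>x\<in>V. f x \<in> W) \<and> (\<forall>x\<in>V. \<forall>y\<in>V. f (x + y) = f x + f y) \<and>
     (\<forall>c. \<forall>x\<in>V. f (sV c x) = sW c (f x))"

text \<open>
  A linear map \<open>U \<rightarrow> gl(V)\<close> is given as a curried function that is bilinear on \<open>U \<times> V\<close>
  with values in \<open>V\<close>.
\<close>

definition bilinear_on ::
  "('k::field \<Rightarrow> 'u::ab_group_add \<Rightarrow> 'u) \<Rightarrow> 'u set \<Rightarrow> ('k \<Rightarrow> 'v::ab_group_add \<Rightarrow> 'v) \<Rightarrow> 'v set
    \<Rightarrow> ('k \<Rightarrow> 'w::ab_group_add \<Rightarrow> 'w) \<Rightarrow> 'w set \<Rightarrow> ('u \<Rightarrow> 'v \<Rightarrow> 'w) \<Rightarrow> bool" where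
  "bilinear_on sU U sV V sW W f \<longleftrightarrow>
     (\<forall>u\<in>U. linear_on sV V sW W (f u)) \<and> (\<forall>v\<in>V. linear_on sU U sW W (\<lambda>u. f u v))"

definition fun_scale :: "'k::field \<Rightarrow> ('x \<Rightarrow> 'k) \<Rightarrow> 'x \<Rightarrow> 'k" where
  "fun_scale c f = (\<lambda>x. c * f x)"

definition dual_space :: "('k::field \<Rightarrow> 'a::ab_group_add \<Rightarrow> 'a) \<Rightarrow> ('a \<Rightarrow> 'k) set" where
  "dual_space scale = {\<xi>. Vector_Spaces.linear scale (*) \<xi>}"


section \<open>Tensor powers of a finite-dimensional space\<close>

text \<open>
  The pure tensor \<open>a \<otimes> b\<close> is realised as the bilinear form \<open>(\<xi>, \<eta>) \<mapsto> \<xi>(a) \<eta>(b)\<close> on the dual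
  space (extended by zero), and \<open>A \<otimes> A\<close> is the span of the pure tensors; similarly for
  \<open>A \<otimes> A \<otimes> A\<close>. Linear maps out of tensor powers are defined only through the universal property:
  \<open>tensor_lift scale f\<close> is the linear map sending \<open>a \<otimes> b\<close> to \<open>f a b\<close>. That it is well defined
  for every bilinear \<open>f\<close> is proved in \<open>tensor_lift_sum\<close> and \<open>tensor3_lift_sum\<close>.
\<close>

type_synonym ('a, 'k) tensor2 = "('a \<Rightarrow> 'k) \<times> ('a \<Rightarrow> 'k) \<Rightarrow> 'k"
type_synonym ('a, 'k) tensor3 = "('a \<Rightarrow> 'k) \<times> ('a \<Rightarrow> 'k) \<times> ('a \<Rightarrow> 'k) \<Rightarrow> 'k"

definition tensor ::
  "('k::field \<Rightarrow> 'a::ab_group_add \<Rightarrow> 'a) \<Rightarrow> 'a \<Rightarrow> 'a \<Rightarrow> ('a, 'k) tensor2" where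
  "tensor scale a b = (\<lambda>(\<xi>, \<eta>).
     if \<xi> \<in> dual_space scale \<and> \<eta> \<in> dual_space scale then \<xi> a * \<eta> b else 0)"

definition tensor3 ::
  "('k::field \<Rightarrow> 'a::ab_group_add \<Rightarrow> 'a) \<Rightarrow> 'a \<Rightarrow> 'a \<Rightarrow> 'a \<Rightarrow> ('a, 'k) tensor3" where
  "tensor3 scale a b c = (\<lambda>(\<xi>, \<eta>, \<zeta>).
     if \<xi> \<in> dual_space scale \<and> \<eta> \<in> dual_space scale \<and> \<zeta> \<in> dual_space scale
     then \<xi> a * \<eta> b * \<zeta> c else 0)"

definition tensor_space ::
  "('k::field \<Rightarrow> 'a::ab_group_add \<Rightarrow> 'a) \<Rightarrow> ('a, 'k) tensor2 set" where
  "tensor_space scale = module.span fun_scale (range (\<lambda>(a, b). tensor scale a b))"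

definition tensor_lift ::
  "('k::field \<Rightarrow> 'a::ab_group_add \<Rightarrow> 'a) \<Rightarrow> ('a \<Rightarrow> 'a \<Rightarrow> 'w::ab_group_add)
    \<Rightarrow> ('a, 'k) tensor2 \<Rightarrow> 'w" where
  "tensor_lift scale f t = (THE w. \<exists>abs.
     t = (\<Sum>(a, b)\<leftarrow>abs. tensor scale a b) \<and> w = (\<Sum>(a, b)\<leftarrow>abs. f a b))"

definition tensor3_lift ::
  "('k::field \<Rightarrow> 'a::ab_group_add \<Rightarrow> 'a) \<Rightarrow> ('a \<Rightarrow> 'a \<Rightarrow> 'a \<Rightarrow> 'w::ab_group_add)
    \<Rightarrow> ('a, 'k) tensor3 \<Rightarrow> 'w" where
  "tensor3_lift scale f t = (THE w. \<exists>abcs.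
     t = (\<Sum>(a, b, c)\<leftarrow>abcs. tensor3 scale a b c) \<and> w = (\<Sum>(a, b, c)\<leftarrow>abcs. f a b c))"

definition tensor_map ::
  "('k::field \<Rightarrow> 'a::ab_group_add \<Rightarrow> 'a) \<Rightarrow> ('a \<Rightarrow> 'a) \<Rightarrow> ('a \<Rightarrow> 'a)
    \<Rightarrow> ('a, 'k) tensor2 \<Rightarrow> ('a, 'k) tensor2" where
  "tensor_map scale f g = tensor_lift scale (\<lambda>a b. tensor scale (f a) (g b))"

definition tensor_swap ::
  "('k::field \<Rightarrow> 'a::ab_group_add \<Rightarrow> 'a) \<Rightarrow> ('a, 'k) tensor2 \<Rightarrow> ('a, 'k) tensor2" where
  "tensor_swap scale = tensor_lift scale (\<lambda>a b. tensor scale b a)"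

text \<open>The maps \<open>\<Delta> \<otimes> id\<close>, \<open>id \<otimes> \<Delta>\<close> from \<open>A \<otimes> A\<close> to \<open>A \<otimes> A \<otimes> A\<close>, and \<open>\<tau> \<otimes> id\<close>.\<close>

definition coprod_tensor_id ::
  "('k::field \<Rightarrow> 'a::ab_group_add \<Rightarrow> 'a) \<Rightarrow> ('a \<Rightarrow> ('a, 'k) tensor2)
    \<Rightarrow> ('a, 'k) tensor2 \<Rightarrow> ('a, 'k) tensor3" where
  "coprod_tensor_id scale \<Delta> =
     tensor_lift scale (\<lambda>a b. tensor_lift scale (\<lambda>c d. tensor3 scale c d b) (\<Delta> a))"

definition id_tensor_coprod ::
  "('k::field \<Rightarrow> 'a::ab_group_add \<Rightarrow> 'a) \<Rightarrow> ('a \<Rightarrow> ('a, 'k) tensor2)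
    \<Rightarrow> ('a, 'k) tensor2 \<Rightarrow> ('a, 'k) tensor3" where
  "id_tensor_coprod scale \<Delta> =
     tensor_lift scale (\<lambda>a b. tensor_lift scale (\<lambda>c d. tensor3 scale a c d) (\<Delta> b))"

definition swap_tensor_id ::
  "('k::field \<Rightarrow> 'a::ab_group_add \<Rightarrow> 'a) \<Rightarrow> ('a, 'k) tensor3 \<Rightarrow> ('a, 'k) tensor3" where
  "swap_tensor_id scale = tensor3_lift scale (\<lambda>a b c. tensor3 scale b a c)"

text \<open>The pairing \<open>\<langle>\<xi> \<otimes> \<eta>, t\<rangle>\<close>.\<close>

definition tensor_pairing ::
  "('k::field \<Rightarrow> 'a::ab_group_add \<Rightarrow> 'a) \<Rightarrow> ('a \<Rightarrow> 'k) \<Rightarrow> ('a \<Rightarrow> 'k)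
    \<Rightarrow> ('a, 'k) tensor2 \<Rightarrow> 'k" where
  "tensor_pairing scale \<xi> \<eta> = tensor_lift scale (\<lambda>a b. \<xi> a * \<eta> b)"


section \<open>Anti-Leibniz algebras, bimodules and matched pairs\<close>

definition anti_leibniz_algebra ::
  "('k::field \<Rightarrow> 'a::ab_group_add \<Rightarrow> 'a) \<Rightarrow> 'a set \<Rightarrow> ('a \<Rightarrow> 'a \<Rightarrow> 'a) \<Rightarrow> bool" where
  "anti_leibniz_algebra s A m \<longleftrightarrow>
     subspace_of s A \<and> bilinear_on s A s A s A m \<and>
     (\<forall>a1\<in>A. \<forall>a2\<in>A. \<forall>a3\<in>A. m a1 (m a2 a3) + m (m a1 a2) a3 + m a2 (m a1 a3) = 0)"

definition left_mult :: "('a \<Rightarrow> 'a \<Rightarrow> 'a) \<Rightarrow> 'a \<Rightarrow> 'a \<Rightarrow> 'a" where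
  "left_mult m a b = m a b"

definition right_mult :: "('a \<Rightarrow> 'a \<Rightarrow> 'a) \<Rightarrow> 'a \<Rightarrow> 'a \<Rightarrow> 'a" where
  "right_mult m a b = m b a"

definition anti_leibniz_bimodule ::
  "('k::field \<Rightarrow> 'a::ab_group_add \<Rightarrow> 'a) \<Rightarrow> 'a set \<Rightarrow> ('a \<Rightarrow> 'a \<Rightarrow> 'a)
    \<Rightarrow> ('k \<Rightarrow> 'v::ab_group_add \<Rightarrow> 'v) \<Rightarrow> 'v set \<Rightarrow> ('a \<Rightarrow> 'v \<Rightarrow> 'v) \<Rightarrow> ('a \<Rightarrow> 'v \<Rightarrow> 'v) \<Rightarrow> bool"
  where
  "anti_leibniz_bimodule sA A m sM M l r \<longleftrightarrow>
     subspace_of sM M \<and> bilinear_on sA A sM M sM M l \<and> bilinear_on sA A sM M sM M r \<and>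
     (\<forall>a1\<in>A. \<forall>a2\<in>A. \<forall>v\<in>M.
        l (m a1 a2) v + l a1 (l a2 v) + l a2 (l a1 v) = 0 \<and>
        l a1 (r a2 v) + r a2 (l a1 v) + r (m a1 a2) v = 0 \<and>
        r (m a1 a2) v + r a2 (r a1 v) + l a1 (r a2 v) = 0)"

text \<open>
  The first three of the six compatibility conditions of a matched pair; the other three are
  the same conditions with the roles of the two algebras exchanged.
\<close>

definition matched_pair_compat ::
  "'a::ab_group_add set \<Rightarrow> 'b::ab_group_add set \<Rightarrow> ('b \<Rightarrow> 'b \<Rightarrow> 'b)
    \<Rightarrow> ('a \<Rightarrow> 'b \<Rightarrow> 'b) \<Rightarrow> ('a \<Rightarrow> 'b \<Rightarrow> 'b) \<Rightarrow> ('b \<Rightarrow> 'a \<Rightarrow> 'a) \<Rightarrow> ('b \<Rightarrow> 'a \<Rightarrow> 'a) \<Rightarrow> bool" where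
  "matched_pair_compat A B mB lA rA lB rB \<longleftrightarrow>
     (\<forall>a\<in>A. \<forall>b1\<in>B. \<forall>b2\<in>B.
        rA a (mB b1 b2) + mB b1 (rA a b2) + mB b2 (rA a b1)
          + rA (lB b2 a) b1 + rA (lB b1 a) b2 = 0 \<and>
        lA a (mB b1 b2) + mB (lA a b1) b2 + mB b1 (lA a b2)
          + lA (rB b1 a) b2 + rA (rB b2 a) b1 = 0 \<and>
        mB (lA a b1) b2 + lA (rB b1 a) b2 - mB (rA a b1) b2 - lA (lB b1 a) b2 = 0)"

definition matched_pair ::
  "('k::field \<Rightarrow> 'a::ab_group_add \<Rightarrow> 'a) \<Rightarrow> 'a set \<Rightarrow> ('a \<Rightarrow> 'a \<Rightarrow> 'a)
    \<Rightarrow> ('k \<Rightarrow> 'b::ab_group_add \<Rightarrow> 'b) \<Rightarrow> 'b set \<Rightarrow> ('b \<Rightarrow> 'b \<Rightarrow> 'b)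
    \<Rightarrow> ('a \<Rightarrow> 'b \<Rightarrow> 'b) \<Rightarrow> ('a \<Rightarrow> 'b \<Rightarrow> 'b) \<Rightarrow> ('b \<Rightarrow> 'a \<Rightarrow> 'a) \<Rightarrow> ('b \<Rightarrow> 'a \<Rightarrow> 'a) \<Rightarrow> bool" where
  "matched_pair sA A mA sB B mB lA rA lB rB \<longleftrightarrow>
     anti_leibniz_algebra sA A mA \<and> anti_leibniz_algebra sB B mB \<and>
     anti_leibniz_bimodule sA A mA sB B lA rA \<and>
     anti_leibniz_bimodule sB B mB sA A lB rB \<and>
     matched_pair_compat A B mB lA rA lB rB \<and>
     matched_pair_compat B A mA lB rB lA rA"


section \<open>Dual maps\<close>

text \<open>
  For \<open>\<psi> : A \<rightarrow> gl(A)\<close>, the map \<open>\<psi>\<^sup>* : A \<rightarrow> gl(A\<^sup>*)\<close> with \<open>\<langle>\<psi>\<^sup>*(a)(\<xi>), v\<rangle> = \<langle>\<xi>, \<psi>(a)(v)\<rangle>\<close>.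
\<close>

definition dual_rep :: "('b \<Rightarrow> 'a \<Rightarrow> 'a) \<Rightarrow> 'b \<Rightarrow> ('a \<Rightarrow> 'k) \<Rightarrow> 'a \<Rightarrow> 'k" where
  "dual_rep \<psi> b \<xi> = (\<lambda>v. \<xi> (\<psi> b v))"

text \<open>
  For \<open>\<psi> : A\<^sup>* \<rightarrow> gl(A\<^sup>*)\<close>, the map \<open>\<psi>\<^sup>* : A\<^sup>* \<rightarrow> gl(A)\<close> with values in \<open>gl(A)\<close> through the
  identification of \<open>A\<^sup>*\<^sup>*\<close> with \<open>A\<close>, that is, \<open>\<langle>\<eta>, \<psi>\<^sup>*(\<xi>)(a)\<rangle> = \<langle>\<psi>(\<xi>)(\<eta>), a\<rangle>\<close> for all \<open>\<eta>\<close>. Existence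
  and uniqueness of this vector are given by \<open>codual_rep_eqI\<close> and \<open>codual_rep_pairing\<close>.
\<close>

definition codual_rep ::
  "('k::field \<Rightarrow> 'a::ab_group_add \<Rightarrow> 'a) \<Rightarrow> (('a \<Rightarrow> 'k) \<Rightarrow> ('a \<Rightarrow> 'k) \<Rightarrow> ('a \<Rightarrow> 'k))
    \<Rightarrow> ('a \<Rightarrow> 'k) \<Rightarrow> 'a \<Rightarrow> 'a" where
  "codual_rep scale \<psi> \<xi> a = (THE c. \<forall>\<eta>\<in>dual_space scale. \<eta> c = \<psi> \<xi> \<eta> a)"


section \<open>Coalgebras, bialgebras and Manin triples\<close>

definition anti_leibniz_coalgebra ::
  "('k::field \<Rightarrow> 'a::ab_group_add \<Rightarrow> 'a) \<Rightarrow> ('a \<Rightarrow> ('a, 'k) tensor2) \<Rightarrow> bool" where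
  "anti_leibniz_coalgebra scale \<Delta> \<longleftrightarrow>
     vector_space scale \<and>
     linear_on scale UNIV fun_scale (tensor_space scale) \<Delta> \<and>
     (\<forall>a. coprod_tensor_id scale \<Delta> (\<Delta> a) + id_tensor_coprod scale \<Delta> (\<Delta> a)
        + swap_tensor_id scale (id_tensor_coprod scale \<Delta> (\<Delta> a)) = 0)"

text \<open>The product \<open>\<Delta>\<^sup>*\<close> on the dual space.\<close>

definition dual_product ::
  "('k::field \<Rightarrow> 'a::ab_group_add \<Rightarrow> 'a) \<Rightarrow> ('a \<Rightarrow> ('a, 'k) tensor2)
    \<Rightarrow> ('a \<Rightarrow> 'k) \<Rightarrow> ('a \<Rightarrow> 'k) \<Rightarrow> 'a \<Rightarrow> 'k" where
  "dual_product scale \<Delta> \<xi> \<eta> = (\<lambda>a. tensor_pairing scale \<xi> \<eta> (\<Delta> a))"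

definition anti_leibniz_bialgebra ::
  "('k::field \<Rightarrow> 'a::ab_group_add \<Rightarrow> 'a) \<Rightarrow> ('a \<Rightarrow> 'a \<Rightarrow> 'a)
    \<Rightarrow> ('a \<Rightarrow> ('a, 'k) tensor2) \<Rightarrow> bool" where
  "anti_leibniz_bialgebra scale m \<Delta> \<longleftrightarrow>
     anti_leibniz_algebra scale UNIV m \<and> anti_leibniz_coalgebra scale \<Delta> \<and>
     (\<forall>a1 a2.
        (let u = tensor_map scale id id (\<Delta> a1) - tensor_swap scale (\<Delta> a1) in
          \<Delta> (m a1 a2)
          + (tensor_map scale id (right_mult m a2) u - tensor_map scale (right_mult m a2) id u
              + tensor_map scale (left_mult m a2) id u)
          + (tensor_map scale id (left_mult m a1) (\<Delta> a2)
              + tensor_map scale (left_mult m a1) id (\<Delta> a2)) = 0) \<and>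
        tensor_map scale (right_mult m a1) id (\<Delta> a2)
          - tensor_swap scale (tensor_map scale (right_mult m a2) id (\<Delta> a1)) = 0)"

definition invariant_form ::
  "'v::ab_group_add set \<Rightarrow> ('v \<Rightarrow> 'v \<Rightarrow> 'v) \<Rightarrow> ('v \<Rightarrow> 'v \<Rightarrow> 'k) \<Rightarrow> bool" where
  "invariant_form V m B \<longleftrightarrow> (\<forall>x\<in>V. \<forall>y\<in>V. \<forall>z\<in>V. B (m x y) z = B x (m y z - m z y))"

text \<open>The space \<open>A \<oplus> A\<^sup>*\<close> is the subspace \<open>UNIV \<times> dual_space scale\<close>.\<close>

definition double_scale ::
  "('k::field \<Rightarrow> 'a \<Rightarrow> 'a) \<Rightarrow> 'k \<Rightarrow> 'a \<times> ('a \<Rightarrow> 'k) \<Rightarrow> 'a \<times> ('a \<Rightarrow> 'k)" where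
  "double_scale scale c = (\<lambda>(a, \<xi>). (scale c a, fun_scale c \<xi>))"

definition double_form :: "'a \<times> ('a \<Rightarrow> 'k::field) \<Rightarrow> 'a \<times> ('a \<Rightarrow> 'k) \<Rightarrow> 'k" where
  "double_form = (\<lambda>(a1, \<xi>1) (a2, \<xi>2). \<xi>1 a2 - \<xi>2 a1)"

definition standard_manin_triple ::
  "('k::field \<Rightarrow> 'a::ab_group_add \<Rightarrow> 'a) \<Rightarrow> ('a \<Rightarrow> 'a \<Rightarrow> 'a)
    \<Rightarrow> (('a \<Rightarrow> 'k) \<Rightarrow> ('a \<Rightarrow> 'k) \<Rightarrow> ('a \<Rightarrow> 'k))
    \<Rightarrow> ('a \<times> ('a \<Rightarrow> 'k) \<Rightarrow> 'a \<times> ('a \<Rightarrow> 'k) \<Rightarrow> 'a \<times> ('a \<Rightarrow> 'k)) \<Rightarrow> bool" where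
  "standard_manin_triple scale mA mD m \<longleftrightarrow>
     anti_leibniz_algebra scale UNIV mA \<and>
     anti_leibniz_algebra fun_scale (dual_space scale) mD \<and>
     anti_leibniz_algebra (double_scale scale) (UNIV \<times> dual_space scale) m \<and>
     (\<forall>a b. m (a, 0) (b, 0) = (mA a b, 0)) \<and>
     (\<forall>\<xi>\<in>dual_space scale. \<forall>\<eta>\<in>dual_space scale. m (0, \<xi>) (0, \<eta>) = (0, mD \<xi> \<eta>)) \<and>
     invariant_form (UNIV \<times> dual_space scale) m double_form"


section \<open>Well-definedness\<close>

lemma vector_space_fun_scale: "vector_space (fun_scale :: 'k::field \<Rightarrow> ('x \<Rightarrow> 'k) \<Rightarrow> 'x \<Rightarrow> 'k)"
  by unfold_locales (auto simp: fun_scale_def fun_eq_iff algebra_simps)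

context finite_dimensional_vector_space
begin

lemma coord_in_dual: "(\<lambda>a. representation Basis a i) \<in> dual_space scale"
proof -
  have *: "Vector_Spaces.linear scale (*) (\<lambda>a. representation Basis a i)"
    by unfold_locales
       (auto simp: algebra_simps representation_add representation_scale independent_Basis span_Basis)
  then show ?thesis by (simp add: dual_space_def)
qed

lemma coord_expansion: "(\<Sum>i\<in>Basis. scale (representation Basis a i) i) = a"
  using sum_representation_eq[OF independent_Basis _ finite_Basis order_refl]
  by (simp add: span_Basis)

lemma linear_coord_expansion:
  assumes "linear_on scale UNIV sW UNIV f"
  shows "f a = (\<Sum>i\<in>Basis. sW (representation Basis a i) (f i))"
proof -
  have add: "f (x + y) = f x + f y" and sc: "f (scale c x) = sW c (f x)" for x y c
    using assms by (auto simp: linear_on_def)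
  have f0: "f 0 = 0" using add[of 0 0] by simp
  have "f (\<Sum>i\<in>S. g i) = (\<Sum>i\<in>S. f (g i))" if "finite S" for g :: "'b \<Rightarrow> 'b" and S
    using that by (induction S) (auto simp: f0 add)
  from this[OF finite_Basis, of "\<lambda>i. scale (representation Basis a i) i"] show ?thesis
    by (simp add: coord_expansion sc)
qed

end

text \<open>
  The following lemmas are the universal property of the tensor powers: a list of pairs whose
  pure tensors sum to \<open>t\<close> determines \<open>tensor_lift scale f t\<close>.
\<close>

lemma (in finite_dimensional_vector_space) tensor_lift_sum:
  assumes W: "vector_space sW" and f: "bilinear_on scale UNIV scale UNIV sW UNIV f"
  shows "tensor_lift scale f (\<Sum>(a, b)\<leftarrow>xs. tensor scale a b) = (\<Sum>(a, b)\<leftarrow>xs. f a b)"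
proof -
  interpret W: vector_space sW by (fact W)
  let ?c = "\<lambda>i a. representation Basis a i"
  let ?T = "\<lambda>ys. \<Sum>(a, b)\<leftarrow>ys. tensor scale a b"
  have f1: "linear_on scale UNIV sW UNIV (f a)" for a using f by (simp add: bilinear_on_def)
  have f2: "linear_on scale UNIV sW UNIV (\<lambda>a. f a b)" for b using f by (simp add: bilinear_on_def)
  have fe: "f a b = (\<Sum>i\<in>Basis. \<Sum>j\<in>Basis. sW (?c i a * ?c j b) (f i j))" for a b
    by (subst linear_coord_expansion[OF f2], subst linear_coord_expansion[OF f1])
       (simp add: W.scale_sum_right)
  have key: "(\<Sum>(a, b)\<leftarrow>ys. f a b) = (\<Sum>i\<in>Basis. \<Sum>j\<in>Basis. sW (?T ys (?c i, ?c j)) (f i j))" for ys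
  proof (induction ys)
    case Nil then show ?case by simp
  next
    case (Cons p ys)
    obtain a b where p: "p = (a, b)" by force
    show ?case using Cons
      by (simp add: p fe[of a b] tensor_def coord_in_dual W.scale_left_distrib sum.distrib)
  qed
  show ?thesis unfolding tensor_lift_def
    by (rule the_equality) (auto simp: key)
qed

lemma (in finite_dimensional_vector_space) tensor3_lift_sum:
  assumes W: "vector_space sW"
    and f1: "\<And>b c. linear_on scale UNIV sW UNIV (\<lambda>a. f a b c)"
    and f2: "\<And>a c. linear_on scale UNIV sW UNIV (\<lambda>b. f a b c)"
    and f3: "\<And>a b. linear_on scale UNIV sW UNIV (\<lambda>c. f a b c)"
  shows "tensor3_lift scale f (\<Sum>(a, b, c)\<leftarrow>xs. tensor3 scale a b c) = (\<Sum>(a, b, c)\<leftarrow>xs. f a b c)"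
proof -
  interpret W: vector_space sW by (fact W)
  let ?c = "\<lambda>i a. representation Basis a i"
  let ?T = "\<lambda>ys. \<Sum>(a, b, c)\<leftarrow>ys. tensor3 scale a b c"
  have fe: "f a b c = (\<Sum>i\<in>Basis. \<Sum>j\<in>Basis. \<Sum>k\<in>Basis.
      sW (?c i a * ?c j b * ?c k c) (f i j k))" for a b c
    by (subst linear_coord_expansion[OF f1], subst linear_coord_expansion[OF f2],
        subst linear_coord_expansion[OF f3])
       (simp add: W.scale_sum_right mult.assoc)
  have key: "(\<Sum>(a, b, c)\<leftarrow>ys. f a b c) =
      (\<Sum>i\<in>Basis. \<Sum>j\<in>Basis. \<Sum>k\<in>Basis. sW (?T ys (?c i, ?c j, ?c k)) (f i j k))" for ys
  proof (induction ys)
    case Nil then show ?case by simp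
  next
    case (Cons p ys)
    obtain a b c where p: "p = (a, b, c)" by (metis prod_cases3)
    show ?case using Cons
      by (simp add: p fe[of a b c] tensor3_def coord_in_dual W.scale_left_distrib sum.distrib)
  qed
  show ?thesis unfolding tensor3_lift_def
    by (rule the_equality) (auto simp: key)
qed

lemma bilinear_on_tensor:
  assumes "vector_space (scale :: 'k::field \<Rightarrow> 'a::ab_group_add \<Rightarrow> 'a)"
  shows "bilinear_on scale UNIV scale UNIV fun_scale (tensor_space scale) (tensor scale)"
proof -
  interpret F: vector_space "fun_scale :: 'k \<Rightarrow> (('a \<Rightarrow> 'k) \<times> ('a \<Rightarrow> 'k) \<Rightarrow> 'k) \<Rightarrow> _"
    by (rule vector_space_fun_scale)
  have "tensor scale a b \<in> tensor_space scale" for a b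
    unfolding tensor_space_def by (rule F.span_base) (rule range_eqI[of _ _ "(a, b)"], simp)
  then show ?thesis
    by (auto simp: bilinear_on_def linear_on_def tensor_def fun_scale_def fun_eq_iff dual_space_def
        linear_iff_module_hom module_hom.add module_hom.scale algebra_simps)
qed

lemma tensor_space_eq_sums:
  assumes "vector_space (scale :: 'k::field \<Rightarrow> 'a::ab_group_add \<Rightarrow> 'a)"
  shows "tensor_space scale = range (\<lambda>xs. \<Sum>(a, b)\<leftarrow>xs. tensor scale a b)"
proof -
  interpret F: vector_space "fun_scale :: 'k \<Rightarrow> (('a \<Rightarrow> 'k) \<times> ('a \<Rightarrow> 'k) \<Rightarrow> 'k) \<Rightarrow> _"
    by (rule vector_space_fun_scale)
  let ?T = "\<lambda>xs. \<Sum>(a, b)\<leftarrow>xs. tensor scale a b"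
  have sc: "fun_scale c (tensor scale a b) = tensor scale (scale c a) b" for c a b
    by (auto simp: fun_scale_def tensor_def fun_eq_iff dual_space_def linear_iff_module_hom
        module_hom.scale mult.assoc)
  have scT: "fun_scale c (?T xs) = ?T (map (\<lambda>(a, b). (scale c a, b)) xs)" for c xs
  proof (induction xs)
    case Nil then show ?case by (simp add: fun_scale_def fun_eq_iff)
  next
    case (Cons p xs)
    obtain a b where p: "p = (a, b)" by force
    have "fun_scale c (?T (p # xs)) = fun_scale c (tensor scale a b) + fun_scale c (?T xs)"
      by (simp only: p list.map sum_list.Cons prod.case F.scale_right_distrib)
    also have "\<dots> = ?T (map (\<lambda>(a, b). (scale c a, b)) (p # xs))"
      by (simp only: Cons.IH sc p list.map sum_list.Cons prod.case)
    finally show ?case .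
  qed
  have "module.subspace fun_scale (range ?T)"
  proof (rule F.subspaceI)
    show "0 \<in> range ?T" by (rule range_eqI[of _ _ "[]"]) simp
    show "x + y \<in> range ?T" if "x \<in> range ?T" "y \<in> range ?T" for x y
    proof -
      from that obtain xs ys where "x = ?T xs" "y = ?T ys" by blast
      then show ?thesis by (intro range_eqI[of _ _ "xs @ ys"]) simp
    qed
    show "fun_scale c x \<in> range ?T" if "x \<in> range ?T" for c x
      using that scT by fastforce
  qed
  moreover have "range (\<lambda>(a, b). tensor scale a b) \<subseteq> range ?T"
  proof clarify
    fix a b show "tensor scale a b \<in> range ?T" by (rule range_eqI[of _ _ "[(a, b)]"]) simp
  qed
  ultimately have 1: "tensor_space scale \<subseteq> range ?T"
    unfolding tensor_space_def by (rule F.span_minimal[rotated])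
  have 2: "?T xs \<in> tensor_space scale" for xs
    unfolding tensor_space_def
  proof (induction xs)
    case Nil
    show ?case by (simp only: list.map sum_list.Nil F.span_zero)
  next
    case (Cons p xs)
    show ?case unfolding list.map sum_list.Cons
      by (rule F.span_add[OF F.span_base Cons.IH]) (rule rangeI)
  qed
  from 1 2 show ?thesis by blast
qed

lemma (in finite_dimensional_vector_space) codual_rep_eqI:
  assumes "\<forall>\<eta>\<in>dual_space scale. \<eta> c = \<psi> \<xi> \<eta> a"
  shows "codual_rep scale \<psi> \<xi> a = c"
  unfolding codual_rep_def
proof (rule the_equality)
  fix d assume d: "\<forall>\<eta>\<in>dual_space scale. \<eta> d = \<psi> \<xi> \<eta> a"
  have "representation Basis d i = representation Basis c i" for i
    using d assms coord_in_dual[of i] by force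
  then show "d = c"
    using coord_expansion[of c] coord_expansion[of d] by simp
qed (use assms in auto)

lemma (in finite_dimensional_vector_space) codual_rep_pairing:
  assumes \<psi>: "linear_on fun_scale (dual_space scale) fun_scale (dual_space scale) (\<psi> \<xi>)"
    and \<eta>: "\<eta> \<in> dual_space scale"
  shows "\<eta> (codual_rep scale \<psi> \<xi> a) = \<psi> \<xi> \<eta> a"
proof -
  let ?c = "\<lambda>i a. representation Basis a i"
  interpret F: vector_space "fun_scale :: 'a \<Rightarrow> ('b \<Rightarrow> 'a) \<Rightarrow> _"
    by (rule vector_space_fun_scale)
  have D: "\<theta> \<in> dual_space scale \<longleftrightarrow>
      (\<forall>x y. \<theta> (x + y) = \<theta> x + \<theta> y) \<and> (\<forall>c x. \<theta> (scale c x) = c * \<theta> x)" for \<theta>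
  proof
    assume "\<theta> \<in> dual_space scale"
    then show "(\<forall>x y. \<theta> (x + y) = \<theta> x + \<theta> y) \<and> (\<forall>c x. \<theta> (scale c x) = c * \<theta> x)"
      by (auto simp: dual_space_def linear_iff_module_hom module_hom.scale module_hom.add)
  next
    assume "(\<forall>x y. \<theta> (x + y) = \<theta> x + \<theta> y) \<and> (\<forall>c x. \<theta> (scale c x) = c * \<theta> x)"
    then show "\<theta> \<in> dual_space scale"
      unfolding dual_space_def mem_Collect_eq
      by unfold_locales (auto simp: algebra_simps)
  qed
  have lin: "linear_on scale UNIV (*) UNIV \<theta>" if "\<theta> \<in> dual_space scale" for \<theta>
    using that by (auto simp: D linear_on_def)
  define d where "d = (\<Sum>i\<in>Basis. scale (\<psi> \<xi> (?c i) a) i)"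
  have sums: "(\<Sum>i\<in>S. fun_scale (g i) (?c i)) \<in> dual_space scale \<and>
      \<psi> \<xi> (\<Sum>i\<in>S. fun_scale (g i) (?c i)) = (\<Sum>i\<in>S. fun_scale (g i) (\<psi> \<xi> (?c i)))"
    if "finite S" for S g
    using that
  proof induction
    case empty
    have "0 \<in> dual_space scale" by (simp add: D)
    moreover from this have "\<psi> \<xi> (fun_scale 0 0) = fun_scale 0 (\<psi> \<xi> 0)"
      using \<psi> unfolding linear_on_def by blast
    ultimately show ?case by (simp add: fun_scale_def zero_fun_def)
  next
    case (insert i S)
    have s: "fun_scale (g i) (?c i) \<in> dual_space scale"
      using coord_in_dual[of i] by (simp add: D fun_scale_def algebra_simps)
    have "fun_scale (g i) (?c i) + (\<Sum>i\<in>S. fun_scale (g i) (?c i)) \<in> dual_space scale"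
      using s insert.IH by (simp add: D algebra_simps)
    moreover have "\<psi> \<xi> (fun_scale (g i) (?c i)) = fun_scale (g i) (\<psi> \<xi> (?c i))"
      using \<psi> coord_in_dual unfolding linear_on_def by blast
    moreover have "\<psi> \<xi> (fun_scale (g i) (?c i) + (\<Sum>i\<in>S. fun_scale (g i) (?c i)))
        = \<psi> \<xi> (fun_scale (g i) (?c i)) + \<psi> \<xi> (\<Sum>i\<in>S. fun_scale (g i) (?c i))"
      using \<psi> s insert.IH unfolding linear_on_def by blast
    ultimately show ?case
      unfolding sum.insert[OF insert.hyps] using insert.IH by argo
  qed
  have app: "(\<Sum>i\<in>S. g i) x = (\<Sum>i\<in>S. g i x)" if "finite S"
    for S and g :: "'b \<Rightarrow> 'b \<Rightarrow> 'a" and x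
    using that by (induction S) auto
  have "\<theta> d = \<psi> \<xi> \<theta> a" if \<theta>: "\<theta> \<in> dual_space scale" for \<theta>
  proof -
    have "\<theta> = (\<Sum>i\<in>Basis. fun_scale (\<theta> i) (?c i))"
    proof
      fix x
      show "\<theta> x = (\<Sum>i\<in>Basis. fun_scale (\<theta> i) (?c i)) x"
        by (subst linear_coord_expansion[OF lin[OF \<theta>]])
           (simp add: app[OF finite_Basis] fun_scale_def mult.commute)
    qed
    then have "\<psi> \<xi> \<theta> = (\<Sum>i\<in>Basis. fun_scale (\<theta> i) (\<psi> \<xi> (?c i)))"
      using sums[OF finite_Basis] by metis
    then have "\<psi> \<xi> \<theta> a = (\<Sum>i\<in>Basis. \<theta> i * \<psi> \<xi> (?c i) a)"
      by (simp add: app[OF finite_Basis] fun_scale_def)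
    moreover have "\<theta> (\<Sum>i\<in>S. scale (g i) i) = (\<Sum>i\<in>S. g i * \<theta> i)" for S g
    proof -
      have "\<theta> 0 = 0" using \<theta> unfolding D by (metis add_cancel_left_left)
      with \<theta>[unfolded D] show ?thesis by (induction S rule: infinite_finite_induct) auto
    qed
    ultimately show ?thesis
      by (simp add: d_def mult.commute)
  qed
  then have "codual_rep scale \<psi> \<xi> a = d"
    by (intro codual_rep_eqI) auto
  with \<open>\<And>\<theta>. \<theta> \<in> dual_space scale \<Longrightarrow> \<theta> d = \<psi> \<xi> \<theta> a\<close>[OF \<eta>] show ?thesis by simp
qed

end

theory Submission
  imports Defs
begin

text \<open>The shape of the actions in (i) is dictated by the form. For a skew invariant form every
  left multiplication is self-adjoint, \<open>B (p y x) z = B x (p y z)\<close>, and the adjoint of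
  right multiplication by \<open>y\<close> is the difference of left and right multiplication by
  \<open>y\<close>. Reading these two rules on the pairing of \<open>A\<close> with its dual gives,
  without any sign, the transposes of \<open>l\<close> and of \<open>l - r\<close>.

  Two features of the setting shape the rest. The dual is a set of functions, so every product is
  controlled only on a carrier, and closure has to accompany each rewriting. Tensors are functions
  on pairs of functionals, so identities in tensor powers are turned into scalar identities by
  evaluation: a linear map applied to one tensor factor becomes precomposition of the functional
  placed there.\<close>

text \<open>
  All three conditions say that one product \<open>q\<close> on \<open>A \<oplus> A\<^sup>*\<close>, built from the coadjoint actions, is
  anti-Leibniz. Invariance and nondegeneracy of the form leave no other candidate for the product
  of a Manin triple. Write \<open>J(x, y, z)\<close> for the sum in the anti-Leibniz identity. For an invariant
  product, \<open>K(x, y, z, w) = B(J(x, y, z), w)\<close> is antisymmetric in \<open>z, w\<close>, satisfies a cyclic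
  relation, and \<open>K(x, y, z, w) - K(y, x, z, w) = B([x, y], [z, w])\<close>. Hence \<open>K\<close> vanishes as soon as
  it vanishes on \<open>(\<xi>, a, b, \<eta>)\<close> and \<open>B([\<xi>, a], [b, \<eta>]) = 0\<close>, where \<open>\<xi>, \<eta> \<in> A\<^sup>*\<close> and \<open>a, b \<in> A\<close>. The
  latter is the second bialgebra condition, and modulo it the former is the first one.
\<close>

section \<open>Invariant products\<close>

definition anti_leibnizator :: "('v \<Rightarrow> 'v \<Rightarrow> 'v::ab_group_add) \<Rightarrow> 'v \<Rightarrow> 'v \<Rightarrow> 'v \<Rightarrow> 'v" where
  "anti_leibnizator p x y z = p x (p y z) + p (p x y) z + p y (p x z)"

text \<open>Asks for additivity alone, since splitting arguments into summands uses no scalars. The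
  carrier \<open>V\<close> is explicit because the double is a proper subset of its type.\<close>

locale additive_product =
  fixes V :: "'v::ab_group_add set" and p :: "'v \<Rightarrow> 'v \<Rightarrow> 'v"
  assumes add_closed: "x \<in> V \<Longrightarrow> y \<in> V \<Longrightarrow> x + y \<in> V"
    and diff_closed: "x \<in> V \<Longrightarrow> y \<in> V \<Longrightarrow> x - y \<in> V"
    and prod_closed: "x \<in> V \<Longrightarrow> y \<in> V \<Longrightarrow> p x y \<in> V"
    and prod_add_left: "x \<in> V \<Longrightarrow> y \<in> V \<Longrightarrow> z \<in> V \<Longrightarrow> p (x + y) z = p x z + p y z"
    and prod_add_right: "x \<in> V \<Longrightarrow> y \<in> V \<Longrightarrow> z \<in> V \<Longrightarrow> p x (y + z) = p x y + p x z"
begin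

abbreviation "J \<equiv> anti_leibnizator p"

lemmas closed = add_closed diff_closed prod_closed

lemma J_closed: "x \<in> V \<Longrightarrow> y \<in> V \<Longrightarrow> z \<in> V \<Longrightarrow> J x y z \<in> V"
  by (simp add: anti_leibnizator_def closed)

lemma J_add:
  assumes "x \<in> V" "x' \<in> V" "y \<in> V" "y' \<in> V" "z \<in> V" "z' \<in> V"
  shows "J (x + x') y z = J x y z + J x' y z" "J x (y + y') z = J x y z + J x y' z"
    "J x y (z + z') = J x y z + J x y z'"
  using assms by (simp_all add: anti_leibnizator_def closed prod_add_left prod_add_right)

text \<open>By additivity the arguments may be split one at a time. The last one is split first,
  while the others are still pure, and each stage feeds the next.\<close>

lemma J_eq_0_on_summands:
  assumes U: "U \<subseteq> V" and W: "W \<subseteq> V"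
    and decomp: "\<And>x. x \<in> V \<Longrightarrow> \<exists>u\<in>U. \<exists>w\<in>W. x = u + w"
    and J3: "\<And>x y z. x \<in> U \<union> W \<Longrightarrow> y \<in> U \<union> W \<Longrightarrow> z \<in> U \<union> W \<Longrightarrow> J x y z = 0"
    and V: "x \<in> V" "y \<in> V" "z \<in> V"
  shows "J x y z = 0"
proof -
  have [simp]: "u \<in> V" if "u \<in> U" for u using that U by auto
  have [simp]: "w \<in> V" if "w \<in> W" for w using that W by auto
  have J2: "J x y z = 0" if "x \<in> U \<union> W" "y \<in> U \<union> W" "z \<in> V" for x y z
  proof -
    obtain u v where "u \<in> U" "v \<in> W" "z = u + v" using decomp[OF \<open>z \<in> V\<close>] by blast
    with that show ?thesis using J3[of x y u] J3[of x y v] by (auto simp: J_add)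
  qed
  have J1: "J x y z = 0" if "x \<in> U \<union> W" "y \<in> V" "z \<in> V" for x y z
  proof -
    obtain u v where "u \<in> U" "v \<in> W" "y = u + v" using decomp[OF \<open>y \<in> V\<close>] by blast
    with that show ?thesis using J2[of x u z] J2[of x v z] by (auto simp: J_add)
  qed
  obtain u v where "u \<in> U" "v \<in> W" "x = u + v" using decomp[OF \<open>x \<in> V\<close>] by blast
  with V show ?thesis using J1[of u y z] J1[of v y z] by (auto simp: J_add)
qed

end

locale invariant_product = additive_product V p
  for V :: "'v::ab_group_add set" and p :: "'v \<Rightarrow> 'v \<Rightarrow> 'v" +
  fixes B :: "'v \<Rightarrow> 'v \<Rightarrow> 'k::ab_group_add"
  assumes form_add_left: "x \<in> V \<Longrightarrow> y \<in> V \<Longrightarrow> z \<in> V \<Longrightarrow> B (x + y) z = B x z + B y z"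
    and form_skew: "x \<in> V \<Longrightarrow> y \<in> V \<Longrightarrow> B x y = - B y x"
    and form_invariant: "invariant_form V p B"
begin

section \<open>Adjoints of left and right multiplication\<close>

lemma form_add_right:
  assumes "x \<in> V" "y \<in> V" "z \<in> V"
  shows "B x (y + z) = B x y + B x z"
  using assms form_skew[of x "y + z"] form_skew[of x y] form_skew[of x z]
  by (simp add: closed form_add_left)

lemma form_diff_left:
  assumes "x \<in> V" "y \<in> V" "z \<in> V"
  shows "B (x - y) z = B x z - B y z"
  using form_add_left[of "x - y" y z] assms by (simp add: closed)

lemma form_diff_right:
  assumes "x \<in> V" "y \<in> V" "z \<in> V"
  shows "B x (y - z) = B x y - B x z"
  using form_add_right[of x "y - z" z] assms by (simp add: closed)

lemma right_mult_invariant: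
  assumes "x \<in> V" "y \<in> V" "z \<in> V"
  shows "B (p x y) z = B x (p y z) - B x (p z y)"
  using assms form_invariant by (simp add: invariant_form_def form_diff_right closed)

text \<open>Invariance speaks of right multiplication only. Flipping \<open>B x (p z y)\<close> by
  skewness and applying invariance again produces a second copy of \<open>B (p x y) z\<close>; it
  cancels, and what remains is self-adjointness of left multiplication by \<open>y\<close>.\<close>

lemma left_mult_invariant:
  assumes "x \<in> V" "y \<in> V" "z \<in> V"
  shows "B (p y x) z = B x (p y z)"
proof -
  have "B x (p z y) = - (B z (p y x) - B z (p x y))"
    using assms form_skew[of x "p z y"] by (simp add: closed right_mult_invariant)
  also have "\<dots> = B (p y x) z - B (p x y) z"
    using assms form_skew[of "p y x" z] form_skew[of "p x y" z] by (simp add: closed)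
  finally show ?thesis
    using right_mult_invariant[OF assms] by simp
qed

text \<open>As an operator on \<open>z\<close>, \<open>J x y z\<close> is the anticommutator of the
  left multiplications by \<open>x\<close> and \<open>y\<close> plus the left multiplication by
  \<open>p x y\<close>. All of these are self-adjoint up to exchanging the factors of the
  anticommutator, so the sum is self-adjoint, which for a skew form means antisymmetry in
  \<open>z\<close> and \<open>w\<close>.\<close>

lemma J_swap:
  assumes V: "x \<in> V" "y \<in> V" "z \<in> V" "w \<in> V"
  shows "B (J x y z) w = - B (J x y w) z"
proof -
  have "B (J x y z) w = B z (p y (p x w)) + B z (p (p x y) w) + B z (p x (p y w))"
    using V by (simp add: anti_leibnizator_def form_add_left closed left_mult_invariant)
  also have "\<dots> = B z (J x y w)"
    using V by (simp add: anti_leibnizator_def form_add_right closed)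
  finally show ?thesis using V form_skew[of z "J x y w"] by (simp add: J_closed)
qed

text \<open>Moving \<open>x\<close> to the left slot by invariance leaves eight terms paired with
  \<open>x\<close>. Six of them make up \<open>J y z w\<close> and \<open>- J y w z\<close>. The
  other two are the difference of \<open>p (p w z) y\<close> and \<open>p (p z w) y\<close>, which
  is \<open>J w z y - J z w y\<close>, because the remaining terms of these two are symmetric in
  \<open>z\<close> and \<open>w\<close>.\<close>

lemma J_cycle:
  assumes V: "x \<in> V" "y \<in> V" "z \<in> V" "w \<in> V"
  shows "B (J x y z) w = B (J y w z) x - B (J y z w) x + B (J z w y) x - B (J w z y) x"
proof -
  have 1: "B (p x (p y z)) w = B x (p (p y z) w) - B x (p w (p y z))"
    using V by (simp add: right_mult_invariant closed)
  have 2: "B (p (p x y) z) w =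
      B x (p y (p z w)) - B x (p (p z w) y) - (B x (p y (p w z)) - B x (p (p w z) y))"
    using V by (simp add: right_mult_invariant closed)
  have 3: "B (p y (p x z)) w = B x (p z (p y w)) - B x (p (p y w) z)"
    using V
    by (simp add: left_mult_invariant[of "p x z" y w] right_mult_invariant[of x z "p y w"] closed)
  have s: "B (J a b c) x = - B x (J a b c)" if "a \<in> V" "b \<in> V" "c \<in> V" for a b c
    using that V by (intro form_skew) (auto simp: J_closed)
  have "B (J x y z) w = B (p x (p y z)) w + B (p (p x y) z) w + B (p y (p x z)) w"
    using V by (simp add: anti_leibnizator_def form_add_left closed)
  moreover have "B x (J a b c) = B x (p a (p b c)) + B x (p (p a b) c) + B x (p b (p a c))"
    if "a \<in> V" "b \<in> V" "c \<in> V" for a b c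
    using that V by (simp add: anti_leibnizator_def form_add_right closed)
  ultimately show ?thesis
    using V by (simp add: s 1 2 3)
qed

text \<open>The terms \<open>p x (p y z) + p y (p x z)\<close> are symmetric in \<open>x\<close> and
  \<open>y\<close>, so only the left multiplication by the commutator survives. Invariance then
  moves \<open>z\<close> across the form.\<close>

lemma J_commutator:
  assumes V: "x \<in> V" "y \<in> V" "z \<in> V" "w \<in> V"
  shows "B (J x y z) w - B (J y x z) w = B (p x y - p y x) (p z w - p w z)"
  using V
  by (simp add: anti_leibnizator_def form_add_left form_diff_left form_diff_right closed
      right_mult_invariant[of "p x y"] right_mult_invariant[of "p y x"])

text \<open>A mixed product is tested against each summand, and an adjoint brings two elements of
  the same summand together: for \<open>u\<close> in \<open>U\<close> and \<open>w\<close> in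
  \<open>W\<close>, \<open>B (p u w) z\<close> equals \<open>B w (p u z)\<close> when
  \<open>z\<close> is in \<open>U\<close>, and \<open>B u (p w z - p z w)\<close> when
  \<open>z\<close> is in \<open>W\<close>. Both values depend only on the products inside the
  summands.\<close>

lemma product_unique:
  assumes q: "invariant_product V q B"
    and U: "U \<subseteq> V" and W: "W \<subseteq> V"
    and decomp: "\<And>x. x \<in> V \<Longrightarrow> \<exists>u\<in>U. \<exists>w\<in>W. x = u + w"
    and nondegenerate: "\<And>x. x \<in> V \<Longrightarrow> (\<And>y. y \<in> V \<Longrightarrow> B x y = 0) \<Longrightarrow> x = 0"
    and qU: "\<And>x y. x \<in> U \<Longrightarrow> y \<in> U \<Longrightarrow> q x y = p x y"
    and qW: "\<And>x y. x \<in> W \<Longrightarrow> y \<in> W \<Longrightarrow> q x y = p x y"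
    and V: "x \<in> V" "y \<in> V"
  shows "q x y = p x y"
proof -
  interpret q: invariant_product V q B by (fact q)
  have [simp]: "u \<in> V" if "u \<in> U" for u using that U by auto
  have [simp]: "w \<in> V" if "w \<in> W" for w using that W by auto
  have agree: "q x y = p x y" if "x \<in> V" "y \<in> V"
    and *: "\<And>z. z \<in> U \<union> W \<Longrightarrow> B (q x y) z = B (p x y) z" for x y
  proof -
    have "B (q x y - p x y) z = 0" if "z \<in> V" for z
    proof -
      obtain u w where "u \<in> U" "w \<in> W" "z = u + w" using decomp[OF \<open>z \<in> V\<close>] by blast
      then show ?thesis
        using *[of u] *[of w] \<open>x \<in> V\<close> \<open>y \<in> V\<close>
        by (simp add: form_diff_left form_add_right closed q.closed)
    qed
    then have "q x y - p x y = 0"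
      using that by (intro nondegenerate) (auto intro: closed q.closed)
    then show ?thesis by simp
  qed
  have UW: "q u w = p u w" if "u \<in> U" "w \<in> W" for u w
  proof (rule agree)
    fix z assume "z \<in> U \<union> W"
    then show "B (q u w) z = B (p u w) z"
    proof
      assume "z \<in> U"
      with that show ?thesis by (simp add: left_mult_invariant q.left_mult_invariant qU)
    next
      assume "z \<in> W"
      with that show ?thesis by (simp add: right_mult_invariant q.right_mult_invariant qW)
    qed
  qed (use that in auto)
  have WU: "q w u = p w u" if "u \<in> U" "w \<in> W" for u w
  proof (rule agree)
    fix z assume "z \<in> U \<union> W"
    then show "B (q w u) z = B (p w u) z"
    proof
      assume "z \<in> W"
      with that show ?thesis by (simp add: left_mult_invariant q.left_mult_invariant qW)
    next
      assume "z \<in> U"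
      with that show ?thesis by (simp add: right_mult_invariant q.right_mult_invariant qU)
    qed
  qed (use that in auto)
  obtain u w where x: "u \<in> U" "w \<in> W" "x = u + w" using decomp[OF \<open>x \<in> V\<close>] by blast
  obtain u' w' where y: "u' \<in> U" "w' \<in> W" "y = u' + w'" using decomp[OF \<open>y \<in> V\<close>] by blast
  show ?thesis
    using x y by (simp add: prod_add_left prod_add_right q.prod_add_left q.prod_add_right closed
        UW WU qU qW)
qed

text \<open>By nondegeneracy it is enough to treat the sixteen types of \<open>B (J x y z) w\<close>
  with entries in \<open>U\<close> or \<open>W\<close>. Six types have two entries of each kind:
  (W,U,U,W) is given, the commutator condition yields (U,W,U,W), antisymmetry yields (W,U,W,U) and
  (U,W,W,U), and the last two come from the cyclic relation. The other ten have at least three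
  entries of one kind and go back to \<open>JU\<close> and \<open>JW\<close>.\<close>

theorem J_eq_0_iff:
  assumes U: "U \<subseteq> V" and W: "W \<subseteq> V"
    and decomp: "\<And>x. x \<in> V \<Longrightarrow> \<exists>u\<in>U. \<exists>w\<in>W. x = u + w"
    and nondegenerate: "\<And>x. x \<in> V \<Longrightarrow> (\<And>y. y \<in> V \<Longrightarrow> B x y = 0) \<Longrightarrow> x = 0"
    and JU: "\<And>x y z. x \<in> U \<Longrightarrow> y \<in> U \<Longrightarrow> z \<in> U \<Longrightarrow> J x y z = 0"
    and JW: "\<And>x y z. x \<in> W \<Longrightarrow> y \<in> W \<Longrightarrow> z \<in> W \<Longrightarrow> J x y z = 0"
  shows "(\<forall>x\<in>V. \<forall>y\<in>V. \<forall>z\<in>V. J x y z = 0) \<longleftrightarrow>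
    (\<forall>w\<in>W. \<forall>u\<in>U. \<forall>u'\<in>U. \<forall>w'\<in>W.
      B (J w u u') w' = 0 \<and> B (p w u - p u w) (p u' w' - p w' u') = 0)"
    (is "?L \<longleftrightarrow> ?R")
proof
  have zero: "B 0 x = 0" if "x \<in> V" for x
    using that form_diff_left[of x x x] by simp
  show ?R if ?L
  proof (intro ballI conjI)
    fix w u u' w' assume "w \<in> W" "u \<in> U" "u' \<in> U" "w' \<in> W"
    then have V: "w \<in> V" "u \<in> V" "u' \<in> V" "w' \<in> V" using U W by auto
    show "B (J w u u') w' = 0" using V that zero by simp
    show "B (p w u - p u w) (p u' w' - p w' u') = 0"
      using J_commutator[OF V] V that zero by simp
  qed
  show ?L if R: ?R
  proof -
    have [simp]: "u \<in> V" if "u \<in> U" for u using that U by auto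
    have [simp]: "w \<in> V" if "w \<in> W" for w using that W by auto
    have WUUW: "B (J w u u') w' = 0" if "w \<in> W" "u \<in> U" "u' \<in> U" "w' \<in> W" for w u u' w'
      using that R by blast
    have UWUW: "B (J u w u') w' = 0" if "w \<in> W" "u \<in> U" "u' \<in> U" "w' \<in> W" for w u u' w'
      using that R J_commutator[of w u u' w'] WUUW[of w u u' w'] by simp
    have WUWU: "B (J w u w') u' = 0" if "w \<in> W" "u \<in> U" "u' \<in> U" "w' \<in> W" for w u u' w'
      using that J_swap[of w u w' u'] WUUW[of w u u' w'] by simp
    have UWWU: "B (J u w w') u' = 0" if "w \<in> W" "u \<in> U" "u' \<in> U" "w' \<in> W" for w u u' w'
      using that J_swap[of u w w' u'] UWUW[of w u u' w'] by simp
    \<comment> \<open>Two computations give the same right side. The cyclic relation expresses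
      \<open>B (J w w' u) u'\<close> by the two terms of type (U,U,W,W), since its (W,U,U,W) terms
      vanish. The commutator identity, used on both sides of \<open>B\<close> and combined with
      skewness, gives the same expression for \<open>B (J w w' u) u' - B (J w' w u) u'\<close>.
      Subtracting leaves \<open>B (J w' w u) u' = 0\<close>, although the (U,U,W,W) terms are still
      unknown.\<close>
    have WWUU: "B (J w' w u) u' = 0" if "w \<in> W" "w' \<in> W" "u \<in> U" "u' \<in> U" for w w' u u'
    proof -
      have "B (J w w' u) u' = - (B (J u u' w) w' - B (J u' u w) w')"
        using that J_cycle[of w w' u u'] J_swap[of u u' w' w] J_swap[of u' u w' w]
        by (simp add: WUUW)
      moreover have "B (J w w' u) u' - B (J w' w u) u' = - (B (J u u' w) w' - B (J u' u w) w')"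
        using that form_skew[of "p w w' - p w' w" "p u u' - p u' u"]
        by (simp add: J_commutator closed)
      ultimately show ?thesis by simp
    qed
    have UUWW: "B (J u u' w) w' = 0" if "w \<in> W" "w' \<in> W" "u \<in> U" "u' \<in> U" for w w' u u'
      using that J_cycle[of u u' w w'] by (simp add: UWWU WWUU)
    have pure: "B (J x y z) w = 0" if "x \<in> U \<union> W" "y \<in> U \<union> W" "z \<in> U \<union> W" "w \<in> U \<union> W" for x y z w
    proof -
      have UUU: "B (J x y z) w = 0" if "x \<in> U" "y \<in> U" "z \<in> U" "w \<in> V" for x y z w
        using that by (simp add: JU zero)
      have WWW: "B (J x y z) w = 0" if "x \<in> W" "y \<in> W" "z \<in> W" "w \<in> V" for x y z w
        using that by (simp add: JW zero)
      have UUWU: "B (J x y z) w = 0" if "x \<in> U" "y \<in> U" "z \<in> W" "w \<in> U" for x y z w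
        using that J_swap[of x y z w] by (simp add: UUU)
      have WWUW: "B (J x y z) w = 0" if "x \<in> W" "y \<in> W" "z \<in> U" "w \<in> W" for x y z w
        using that J_swap[of x y z w] by (simp add: WWW)
      have WUUU: "B (J x y z) w = 0" if "x \<in> W" "y \<in> U" "z \<in> U" "w \<in> U" for x y z w
        using that J_cycle[of x y z w] by (simp add: UUU)
      have UWWW: "B (J x y z) w = 0" if "x \<in> U" "y \<in> W" "z \<in> W" "w \<in> W" for x y z w
        using that J_cycle[of x y z w] by (simp add: WWW)
      have UWUU: "B (J x y z) w = 0" if "x \<in> U" "y \<in> W" "z \<in> U" "w \<in> U" for x y z w
        using that J_cycle[of x y z w] by (simp add: WUUU UUWU)
      have WUWW: "B (J x y z) w = 0" if "x \<in> W" "y \<in> U" "z \<in> W" "w \<in> W" for x y z w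
        using that J_cycle[of x y z w] by (simp add: UWWW WWUW)
      show ?thesis
        using that
        by (auto simp: UUU WWW UUWU WWUW WUUU UWWW UWUU WUWW WUUW UWUW WUWU UWWU WWUU UUWW)
    qed
    have J4: "B (J x y z) w = 0"
      if "x \<in> U \<union> W" "y \<in> U \<union> W" "z \<in> U \<union> W" "w \<in> V" for x y z w
    proof -
      obtain u v where "u \<in> U" "v \<in> W" "w = u + v" using decomp[OF \<open>w \<in> V\<close>] by blast
      with that show ?thesis
        using pure[of x y z u] pure[of x y z v] by (auto simp: form_add_right J_closed)
    qed
    have J3: "J x y z = 0" if "x \<in> U \<union> W" "y \<in> U \<union> W" "z \<in> U \<union> W" for x y z
      using that by (intro nondegenerate J4) (auto intro!: J_closed)
    show ?L
      using J_eq_0_on_summands[OF U W decomp J3] by blast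
  qed
qed

end

section \<open>Bowtie products and matched pairs\<close>

text \<open>The bicrossed product of two algebras that act on each other from both sides.\<close>

definition bowtie_product ::
  "('a \<Rightarrow> 'a \<Rightarrow> 'a::ab_group_add) \<Rightarrow> ('b \<Rightarrow> 'b \<Rightarrow> 'b::ab_group_add)
    \<Rightarrow> ('a \<Rightarrow> 'b \<Rightarrow> 'b) \<Rightarrow> ('a \<Rightarrow> 'b \<Rightarrow> 'b) \<Rightarrow> ('b \<Rightarrow> 'a \<Rightarrow> 'a) \<Rightarrow> ('b \<Rightarrow> 'a \<Rightarrow> 'a)
    \<Rightarrow> 'a \<times> 'b \<Rightarrow> 'a \<times> 'b \<Rightarrow> 'a \<times> 'b" where
  "bowtie_product mA mB lA rA lB rB = (\<lambda>(a1, b1) (a2, b2).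
     (mA a1 a2 + lB b1 a2 + rB b2 a1, mB b1 b2 + lA a1 b2 + rA a2 b1))"

lemma bilinear_onD:
  assumes "bilinear_on sU U sV V sW W f" "u \<in> U" "v \<in> V"
  shows "f u v \<in> W"
    and "u' \<in> U \<Longrightarrow> f (u + u') v = f u v + f u' v"
    and "v' \<in> V \<Longrightarrow> f u (v + v') = f u v + f u v'"
    and "f (sU c u) v = sW c (f u v)"
    and "f u (sV c v) = sW c (f u v)"
  using assms unfolding bilinear_on_def linear_on_def by blast+

lemma bilinear_on_zero:
  assumes "bilinear_on sU U sV V sW W f"
  shows "0 \<in> U \<Longrightarrow> v \<in> V \<Longrightarrow> f 0 v = 0"
    and "u \<in> U \<Longrightarrow> 0 \<in> V \<Longrightarrow> f u 0 = 0"
  using bilinear_onD(2)[OF assms, of 0 v 0] bilinear_onD(3)[OF assms, of u 0 0] by simp_all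

lemma subspace_ofD:
  assumes "subspace_of s V"
  shows "0 \<in> V" "x \<in> V \<Longrightarrow> y \<in> V \<Longrightarrow> x + y \<in> V" "x \<in> V \<Longrightarrow> y \<in> V \<Longrightarrow> x - y \<in> V"
    "x \<in> V \<Longrightarrow> s c x \<in> V"
proof -
  interpret vector_space s using assms by (simp add: subspace_of_def)
  have "subspace V" using assms by (simp add: subspace_of_def)
  then show "0 \<in> V" "x \<in> V \<Longrightarrow> y \<in> V \<Longrightarrow> x + y \<in> V" "x \<in> V \<Longrightarrow> y \<in> V \<Longrightarrow> x - y \<in> V"
    "x \<in> V \<Longrightarrow> s c x \<in> V"
    by (auto intro: subspace_0 subspace_add subspace_diff subspace_scale)
qed

lemma subspace_of_Times:
  assumes A: "subspace_of sA A" and B: "subspace_of sB B"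
  shows "subspace_of (\<lambda>c (a, b). (sA c a, sB c b)) (A \<times> B)"
proof -
  interpret A: vector_space sA using A by (simp add: subspace_of_def)
  interpret B: vector_space sB using B by (simp add: subspace_of_def)
  interpret P: vector_space "\<lambda>c (a, b). (sA c a, sB c b)"
    by unfold_locales
       (auto simp: A.scale_left_distrib A.scale_right_distrib B.scale_left_distrib
         B.scale_right_distrib)
  show ?thesis
    unfolding subspace_of_def
    by (intro conjI P.vector_space_axioms P.subspaceI)
       (auto simp: zero_prod_def subspace_ofD[OF A] subspace_ofD[OF B])
qed

text \<open>The actions are only bilinear here: the bimodule laws and the compatibility conditions
  are exactly what the anti-Leibniz identity of \<open>q\<close> is to characterise.\<close>

locale bowtie =
  fixes sA :: "'k::field \<Rightarrow> 'a::ab_group_add \<Rightarrow> 'a" and A :: "'a set"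
    and sB :: "'k \<Rightarrow> 'b::ab_group_add \<Rightarrow> 'b" and B :: "'b set"
    and mA mB lA rA lB rB
  assumes algebra_A: "anti_leibniz_algebra sA A mA"
    and algebra_B: "anti_leibniz_algebra sB B mB"
    and bilinear_lA: "bilinear_on sA A sB B sB B lA"
    and bilinear_rA: "bilinear_on sA A sB B sB B rA"
    and bilinear_lB: "bilinear_on sB B sA A sA A lB"
    and bilinear_rB: "bilinear_on sB B sA A sA A rB"
begin

abbreviation "q \<equiv> bowtie_product mA mB lA rA lB rB"

lemma subspace_A: "subspace_of sA A" and bilinear_mA: "bilinear_on sA A sA A sA A mA"
  and anti_leibniz_A: "a1 \<in> A \<Longrightarrow> a2 \<in> A \<Longrightarrow> a3 \<in> A \<Longrightarrow>
    mA a1 (mA a2 a3) + mA (mA a1 a2) a3 + mA a2 (mA a1 a3) = 0"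
  using algebra_A by (auto simp: anti_leibniz_algebra_def)

lemma subspace_B: "subspace_of sB B" and bilinear_mB: "bilinear_on sB B sB B sB B mB"
  and anti_leibniz_B: "b1 \<in> B \<Longrightarrow> b2 \<in> B \<Longrightarrow> b3 \<in> B \<Longrightarrow>
    mB b1 (mB b2 b3) + mB (mB b1 b2) b3 + mB b2 (mB b1 b3) = 0"
  using algebra_B by (auto simp: anti_leibniz_algebra_def)

lemmas sub = subspace_ofD[OF subspace_A] subspace_ofD[OF subspace_B]

lemmas bil = bilinear_onD[OF bilinear_mA] bilinear_onD[OF bilinear_mB]
  bilinear_onD[OF bilinear_lA] bilinear_onD[OF bilinear_rA]
  bilinear_onD[OF bilinear_lB] bilinear_onD[OF bilinear_rB]
  bilinear_on_zero[OF bilinear_lB] bilinear_on_zero[OF bilinear_rB]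
  bilinear_on_zero[OF bilinear_lA] bilinear_on_zero[OF bilinear_rA]
  bilinear_on_zero[OF bilinear_mA] bilinear_on_zero[OF bilinear_mB]

sublocale additive_product "A \<times> B" q
  by unfold_locales
     (auto simp: bowtie_product_def sub bil add.assoc add.left_commute)

lemma bilinear_bowtie:
  "bilinear_on (\<lambda>c (a, b). (sA c a, sB c b)) (A \<times> B) (\<lambda>c (a, b). (sA c a, sB c b)) (A \<times> B)
    (\<lambda>c (a, b). (sA c a, sB c b)) (A \<times> B) q"
proof -
  interpret A: vector_space sA using subspace_A by (simp add: subspace_of_def)
  interpret B: vector_space sB using subspace_B by (simp add: subspace_of_def)
  show ?thesis
    unfolding bilinear_on_def linear_on_def
    by (intro conjI ballI allI prod_closed prod_add_left prod_add_right)
       (auto simp: bowtie_product_def sub bil A.scale_right_distrib B.scale_right_distrib)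
qed

lemma bowtie_anti_leibniz_iff:
  "anti_leibniz_algebra (\<lambda>c (a, b). (sA c a, sB c b)) (A \<times> B) q \<longleftrightarrow>
    (\<forall>x\<in>A \<times> B. \<forall>y\<in>A \<times> B. \<forall>z\<in>A \<times> B. anti_leibnizator q x y z = 0)"
  by (simp only: anti_leibniz_algebra_def bilinear_bowtie
      subspace_of_Times[OF subspace_A subspace_B]
      anti_leibnizator_def simp_thms)

lemma bowtie_pure:
  shows "a \<in> A \<Longrightarrow> a' \<in> A \<Longrightarrow> q (a, 0) (a', 0) = (mA a a', 0)"
    and "b \<in> B \<Longrightarrow> b' \<in> B \<Longrightarrow> q (0, b) (0, b') = (0, mB b b')"
    and "a \<in> A \<Longrightarrow> b \<in> B \<Longrightarrow> q (a, 0) (0, b) = (rB b a, lA a b)"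
    and "a \<in> A \<Longrightarrow> b \<in> B \<Longrightarrow> q (0, b) (a, 0) = (lB b a, rA a b)"
  by (simp_all add: bowtie_product_def sub bil)

text \<open>The conditions of a matched pair are the components of the anti-Leibniz identity on pure
  elements, except that (3) is the difference of the components for \<open>(a, b\<^sub>1, b\<^sub>2)\<close> and
  \<open>(b\<^sub>1, a, b\<^sub>2)\<close>.\<close>

theorem matched_pair_iff_bowtie:
  "matched_pair sA A mA sB B mB lA rA lB rB \<longleftrightarrow>
    anti_leibniz_algebra (\<lambda>c (a, b). (sA c a, sB c b)) (A \<times> B) q"
proof -
  \<comment> \<open>With two entries from \<open>A\<close>, the component in \<open>B\<close> is a
    bimodule law for \<open>B\<close>, and the component in \<open>A\<close> is a compatibility
    condition. The exception is the \<open>A\<close>-component of \<open>ABA\<close>, which is not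
    in the list: it is the second condition minus the third. The triples with two entries from
    \<open>B\<close> behave in the same way.\<close>
  have AAB: "J (a1, 0) (a2, 0) (0, b) =
      (rB b (mA a1 a2) + mA a1 (rB b a2) + mA a2 (rB b a1) + rB (lA a2 b) a1 + rB (lA a1 b) a2,
       lA (mA a1 a2) b + lA a1 (lA a2 b) + lA a2 (lA a1 b))"
    and ABA: "J (a1, 0) (0, b) (a2, 0) =
      (lB b (mA a1 a2) + mA a1 (lB b a2) + mA (rB b a1) a2 + lB (lA a1 b) a2 + rB (rA a2 b) a1,
       lA a1 (rA a2 b) + rA a2 (lA a1 b) + rA (mA a1 a2) b)"
    and BAA: "J (0, b) (a1, 0) (a2, 0) =
      (lB b (mA a1 a2) + mA (lB b a1) a2 + mA a1 (lB b a2) + lB (rA a1 b) a2 + rB (rA a2 b) a1,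
       rA (mA a1 a2) b + rA a2 (rA a1 b) + lA a1 (rA a2 b))"
    if "a1 \<in> A" "a2 \<in> A" "b \<in> B" for a1 a2 b
    using that
    by (simp_all add: anti_leibnizator_def bowtie_product_def sub bil ac_simps)
  have AAA: "J (a1, 0) (a2, 0) (a3, 0) = 0" if "a1 \<in> A" "a2 \<in> A" "a3 \<in> A" for a1 a2 a3
    using that
    by (simp add: anti_leibnizator_def bowtie_product_def sub bil anti_leibniz_A zero_prod_def)
  have BBA: "J (0, b1) (0, b2) (a, 0) =
      (lB (mB b1 b2) a + lB b1 (lB b2 a) + lB b2 (lB b1 a),
       rA a (mB b1 b2) + mB b1 (rA a b2) + mB b2 (rA a b1) + rA (lB b2 a) b1 + rA (lB b1 a) b2)"
    and BAB: "J (0, b1) (a, 0) (0, b2) =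
      (lB b1 (rB b2 a) + rB b2 (lB b1 a) + rB (mB b1 b2) a,
       lA a (mB b1 b2) + mB b1 (lA a b2) + mB (rA a b1) b2 + lA (lB b1 a) b2 + rA (rB b2 a) b1)"
    and ABB: "J (a, 0) (0, b1) (0, b2) =
      (rB (mB b1 b2) a + rB b2 (rB b1 a) + lB b1 (rB b2 a),
       lA a (mB b1 b2) + mB (lA a b1) b2 + mB b1 (lA a b2) + lA (rB b1 a) b2 + rA (rB b2 a) b1)"
    if "b1 \<in> B" "b2 \<in> B" "a \<in> A" for b1 b2 a
    using that
    by (simp_all add: anti_leibnizator_def bowtie_product_def sub bil ac_simps)
  have BBB: "J (0, b1) (0, b2) (0, b3) = 0" if "b1 \<in> B" "b2 \<in> B" "b3 \<in> B" for b1 b2 b3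
    using that
    by (simp add: anti_leibnizator_def bowtie_product_def sub bil anti_leibniz_B zero_prod_def)
  show ?thesis
  proof
    assume mp: "matched_pair sA A mA sB B mB lA rA lB rB"
    note mp = mp[unfolded matched_pair_def anti_leibniz_bimodule_def matched_pair_compat_def]
    have bimod_B: "lA (mA a1 a2) b + lA a1 (lA a2 b) + lA a2 (lA a1 b) = 0"
        "lA a1 (rA a2 b) + rA a2 (lA a1 b) + rA (mA a1 a2) b = 0"
        "rA (mA a1 a2) b + rA a2 (rA a1 b) + lA a1 (rA a2 b) = 0"
      if "a1 \<in> A" "a2 \<in> A" "b \<in> B" for a1 a2 b
      using that mp by blast+
    have bimod_A: "lB (mB b1 b2) a + lB b1 (lB b2 a) + lB b2 (lB b1 a) = 0"
        "lB b1 (rB b2 a) + rB b2 (lB b1 a) + rB (mB b1 b2) a = 0"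
        "rB (mB b1 b2) a + rB b2 (rB b1 a) + lB b1 (rB b2 a) = 0"
      if "b1 \<in> B" "b2 \<in> B" "a \<in> A" for b1 b2 a
      using that mp by blast+
    have compat_B: "rA a (mB b1 b2) + mB b1 (rA a b2) + mB b2 (rA a b1)
          + rA (lB b2 a) b1 + rA (lB b1 a) b2 = 0"
        "lA a (mB b1 b2) + mB (lA a b1) b2 + mB b1 (lA a b2)
          + lA (rB b1 a) b2 + rA (rB b2 a) b1 = 0"
        "mB (lA a b1) b2 + lA (rB b1 a) b2 - mB (rA a b1) b2 - lA (lB b1 a) b2 = 0"
      if "b1 \<in> B" "b2 \<in> B" "a \<in> A" for b1 b2 a
      using that mp by blast+
    have compat_A: "rB b (mA a1 a2) + mA a1 (rB b a2) + mA a2 (rB b a1)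
          + rB (lA a2 b) a1 + rB (lA a1 b) a2 = 0"
        "lB b (mA a1 a2) + mA (lB b a1) a2 + mA a1 (lB b a2)
          + lB (rA a1 b) a2 + rB (rA a2 b) a1 = 0"
        "mA (lB b a1) a2 + lB (rA a1 b) a2 - mA (rB b a1) a2 - lB (lA a1 b) a2 = 0"
      if "a1 \<in> A" "a2 \<in> A" "b \<in> B" for a1 a2 b
      using that mp by blast+
    have "J x y z = 0" if "x \<in> A \<times> B" "y \<in> A \<times> B" "z \<in> A \<times> B" for x y z
    proof (rule J_eq_0_on_summands[of "A \<times> {0}" "{0} \<times> B"])
      show "\<exists>u\<in>A \<times> {0}. \<exists>w\<in>{0} \<times> B. x = u + w" if "x \<in> A \<times> B" for x
        using that by (cases x) force
      have 1: "J (a1, 0) (a2, 0) (0, b) = 0" "J (a1, 0) (0, b) (a2, 0) = 0"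
          "J (0, b) (a1, 0) (a2, 0) = 0"
        if "a1 \<in> A" "a2 \<in> A" "b \<in> B" for a1 a2 b
      proof -
        have "lB b (mA a1 a2) + mA a1 (lB b a2) + mA (rB b a1) a2 + lB (lA a1 b) a2
              + rB (rA a2 b) a1 =
            (lB b (mA a1 a2) + mA (lB b a1) a2 + mA a1 (lB b a2) + lB (rA a1 b) a2
              + rB (rA a2 b) a1)
            - (mA (lB b a1) a2 + lB (rA a1 b) a2 - mA (rB b a1) a2 - lB (lA a1 b) a2)"
          by (simp add: algebra_simps)
        then show "J (a1, 0) (a2, 0) (0, b) = 0" "J (a1, 0) (0, b) (a2, 0) = 0"
          "J (0, b) (a1, 0) (a2, 0) = 0"
          unfolding AAB[OF that] ABA[OF that] BAA[OF that] bimod_B[OF that] compat_A[OF that]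
          by (simp_all add: zero_prod_def)
      qed
      have 2: "J (0, b1) (0, b2) (a, 0) = 0" "J (0, b1) (a, 0) (0, b2) = 0"
          "J (a, 0) (0, b1) (0, b2) = 0"
        if "b1 \<in> B" "b2 \<in> B" "a \<in> A" for b1 b2 a
      proof -
        have "lA a (mB b1 b2) + mB b1 (lA a b2) + mB (rA a b1) b2 + lA (lB b1 a) b2
              + rA (rB b2 a) b1 =
            (lA a (mB b1 b2) + mB (lA a b1) b2 + mB b1 (lA a b2) + lA (rB b1 a) b2
              + rA (rB b2 a) b1)
            - (mB (lA a b1) b2 + lA (rB b1 a) b2 - mB (rA a b1) b2 - lA (lB b1 a) b2)"
          by (simp add: algebra_simps)
        then show "J (0, b1) (0, b2) (a, 0) = 0" "J (0, b1) (a, 0) (0, b2) = 0"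
          "J (a, 0) (0, b1) (0, b2) = 0"
          unfolding BBA[OF that] BAB[OF that] ABB[OF that] bimod_A[OF that] compat_B[OF that]
          by (simp_all add: zero_prod_def)
      qed
      show "J x y z = 0" if "x \<in> A \<times> {0} \<union> {0} \<times> B" "y \<in> A \<times> {0} \<union> {0} \<times> B" "z \<in> A \<times> {0} \<union> {0} \<times> B"
        for x y z
        using that by (auto simp: 1 2 AAA BBB sub)
    qed (use that sub in auto)
    then show "anti_leibniz_algebra (\<lambda>c (a, b). (sA c a, sB c b)) (A \<times> B) q"
      by (simp add: bowtie_anti_leibniz_iff)
  next
    assume "anti_leibniz_algebra (\<lambda>c (a, b). (sA c a, sB c b)) (A \<times> B) q"
    then have J0: "J x y z = 0" if "x \<in> A \<times> B" "y \<in> A \<times> B" "z \<in> A \<times> B" for x y z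
      using that unfolding bowtie_anti_leibniz_iff by blast
    show "matched_pair sA A mA sB B mB lA rA lB rB"
      unfolding matched_pair_def anti_leibniz_bimodule_def matched_pair_compat_def
    proof (intro conjI ballI algebra_A algebra_B subspace_A subspace_B bilinear_lA bilinear_rA
        bilinear_lB bilinear_rB)
      fix a1 a2 b assume A: "a1 \<in> A" "a2 \<in> A" "b \<in> B"
      have V: "(a1, 0) \<in> A \<times> B" "(a2, 0) \<in> A \<times> B" "(0, b) \<in> A \<times> B"
        using A sub by auto
      note J = J0[OF V, unfolded AAB[OF A]] J0[OF V(1,3,2), unfolded ABA[OF A]]
        J0[OF V(3,1,2), unfolded BAA[OF A]]
      show "lA (mA a1 a2) b + lA a1 (lA a2 b) + lA a2 (lA a1 b) = 0"
        "lA a1 (rA a2 b) + rA a2 (lA a1 b) + rA (mA a1 a2) b = 0"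
        "rA (mA a1 a2) b + rA a2 (rA a1 b) + lA a1 (rA a2 b) = 0"
        "rB b (mA a1 a2) + mA a1 (rB b a2) + mA a2 (rB b a1)
          + rB (lA a2 b) a1 + rB (lA a1 b) a2 = 0"
        "lB b (mA a1 a2) + mA (lB b a1) a2 + mA a1 (lB b a2)
          + lB (rA a1 b) a2 + rB (rA a2 b) a1 = 0"
        using J by (simp_all only: zero_prod_def prod.inject)
      have "mA (lB b a1) a2 + lB (rA a1 b) a2 - mA (rB b a1) a2 - lB (lA a1 b) a2 =
          (lB b (mA a1 a2) + mA (lB b a1) a2 + mA a1 (lB b a2) + lB (rA a1 b) a2
            + rB (rA a2 b) a1)
          - (lB b (mA a1 a2) + mA a1 (lB b a2) + mA (rB b a1) a2 + lB (lA a1 b) a2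
            + rB (rA a2 b) a1)"
        by (simp add: algebra_simps)
      then show "mA (lB b a1) a2 + lB (rA a1 b) a2 - mA (rB b a1) a2 - lB (lA a1 b) a2 = 0"
        using J by (simp only: zero_prod_def prod.inject diff_0_right)
    next
      fix b1 b2 a assume B: "b1 \<in> B" "b2 \<in> B" "a \<in> A"
      have V: "(0, b1) \<in> A \<times> B" "(0, b2) \<in> A \<times> B" "(a, 0) \<in> A \<times> B"
        using B sub by auto
      note J = J0[OF V, unfolded BBA[OF B]] J0[OF V(1,3,2), unfolded BAB[OF B]]
        J0[OF V(3,1,2), unfolded ABB[OF B]]
      show "lB (mB b1 b2) a + lB b1 (lB b2 a) + lB b2 (lB b1 a) = 0"
        "lB b1 (rB b2 a) + rB b2 (lB b1 a) + rB (mB b1 b2) a = 0"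
        "rB (mB b1 b2) a + rB b2 (rB b1 a) + lB b1 (rB b2 a) = 0"
        "rA a (mB b1 b2) + mB b1 (rA a b2) + mB b2 (rA a b1)
          + rA (lB b2 a) b1 + rA (lB b1 a) b2 = 0"
        "lA a (mB b1 b2) + mB (lA a b1) b2 + mB b1 (lA a b2)
          + lA (rB b1 a) b2 + rA (rB b2 a) b1 = 0"
        using J by (simp_all only: zero_prod_def prod.inject)
      have "mB (lA a b1) b2 + lA (rB b1 a) b2 - mB (rA a b1) b2 - lA (lB b1 a) b2 =
          (lA a (mB b1 b2) + mB (lA a b1) b2 + mB b1 (lA a b2) + lA (rB b1 a) b2
            + rA (rB b2 a) b1)
          - (lA a (mB b1 b2) + mB b1 (lA a b2) + mB (rA a b1) b2 + lA (lB b1 a) b2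
            + rA (rB b2 a) b1)"
        by (simp add: algebra_simps)
      then show "mB (lA a b1) b2 + lA (rB b1 a) b2 - mB (rA a b1) b2 - lA (lB b1 a) b2 = 0"
        using J by (simp only: zero_prod_def prod.inject diff_0_right)
    qed
  qed
qed

end

section \<open>Evaluation of tensors on the dual space\<close>

context finite_dimensional_vector_space
begin

section \<open>The dual as a subspace that separates vectors\<close>

lemma dual_space_iff:
  "\<xi> \<in> dual_space scale \<longleftrightarrow>
    (\<forall>x y. \<xi> (x + y) = \<xi> x + \<xi> y) \<and> (\<forall>c x. \<xi> (scale c x) = c * \<xi> x)"
proof
  assume "\<xi> \<in> dual_space scale"
  then show "(\<forall>x y. \<xi> (x + y) = \<xi> x + \<xi> y) \<and> (\<forall>c x. \<xi> (scale c x) = c * \<xi> x)"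
    by (auto simp: dual_space_def linear_iff_module_hom module_hom.scale module_hom.add)
next
  assume "(\<forall>x y. \<xi> (x + y) = \<xi> x + \<xi> y) \<and> (\<forall>c x. \<xi> (scale c x) = c * \<xi> x)"
  then show "\<xi> \<in> dual_space scale"
    unfolding dual_space_def mem_Collect_eq
    by unfold_locales (auto simp: algebra_simps)
qed

lemma
  assumes "\<xi> \<in> dual_space scale"
  shows dual_add: "\<xi> (x + y) = \<xi> x + \<xi> y"
    and dual_scale: "\<xi> (scale c x) = c * \<xi> x"
    and dual_zero: "\<xi> 0 = 0"
    and dual_minus: "\<xi> (- x) = - \<xi> x"
    and dual_diff: "\<xi> (x - y) = \<xi> x - \<xi> y"
proof -
  show add: "\<xi> (x + y) = \<xi> x + \<xi> y" for x y using assms by (simp add: dual_space_iff)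
  show "\<xi> (scale c x) = c * \<xi> x" using assms by (simp add: dual_space_iff)
  show zero: "\<xi> 0 = 0" by (metis add add_0_right add_left_cancel)
  show minus: "\<xi> (- x) = - \<xi> x" for x
    using add[of x "- x"] zero by (simp add: eq_neg_iff_add_eq_0 add.commute)
  show "\<xi> (x - y) = \<xi> x - \<xi> y" using add[of x "- y"] minus by simp
qed

lemma subspace_dual: "subspace_of fun_scale (dual_space scale)"
proof -
  interpret F: vector_space "fun_scale :: 'a \<Rightarrow> ('b \<Rightarrow> 'a) \<Rightarrow> _" by (rule vector_space_fun_scale)
  show ?thesis
    unfolding subspace_of_def
    by (intro conjI vector_space_fun_scale F.subspaceI)
       (auto simp: dual_space_iff fun_scale_def algebra_simps)
qed

lemma
  shows zero_in_dual: "0 \<in> dual_space scale"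
    and add_in_dual: "\<xi> \<in> dual_space scale \<Longrightarrow> \<eta> \<in> dual_space scale \<Longrightarrow> \<xi> + \<eta> \<in> dual_space scale"
    and diff_in_dual: "\<xi> \<in> dual_space scale \<Longrightarrow> \<eta> \<in> dual_space scale \<Longrightarrow> \<xi> - \<eta> \<in> dual_space scale"
    and scale_in_dual: "\<xi> \<in> dual_space scale \<Longrightarrow> fun_scale c \<xi> \<in> dual_space scale"
  by (auto simp: dual_space_iff fun_scale_def algebra_simps)

lemma dual_separates:
  assumes "\<And>\<eta>. \<eta> \<in> dual_space scale \<Longrightarrow> \<eta> x = \<eta> y"
  shows "x = y"
proof -
  have "representation Basis x i = representation Basis y i" for i
    using assms[OF coord_in_dual] .
  then have "(\<Sum>i\<in>Basis. scale (representation Basis x i) i) =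
      (\<Sum>i\<in>Basis. scale (representation Basis y i) i)"
    by (simp only:)
  then show ?thesis by (simp only: coord_expansion)
qed

lemma comp_in_dual:
  assumes "\<xi> \<in> dual_space scale" "linear_on scale UNIV scale UNIV f"
  shows "(\<lambda>x. \<xi> (f x)) \<in> dual_space scale"
  using assms by (simp add: dual_space_iff linear_on_def)

lemma bilinear_on_functions:
  assumes "\<And>x b. (\<lambda>a. f a b x) \<in> dual_space scale" "\<And>x a. (\<lambda>b. f a b x) \<in> dual_space scale"
  shows "bilinear_on scale UNIV scale UNIV fun_scale UNIV f"
  using assms by (auto simp: bilinear_on_def linear_on_def dual_space_iff fun_scale_def fun_eq_iff)

lemma tensor_spaceE:
  assumes "t \<in> tensor_space scale"
  obtains xs where "t = (\<Sum>(a, b)\<leftarrow>xs. tensor scale a b)"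
  using assms unfolding tensor_space_eq_sums[OF vector_space_axioms] by blast

text \<open>Equality of tensors is equality of functions on all pairs, including pairs that are not
  linear functionals. This settles those pairs.\<close>

lemma tensor_space_outside_dual:
  assumes "t \<in> tensor_space scale" "\<not> (\<xi> \<in> dual_space scale \<and> \<eta> \<in> dual_space scale)"
  shows "t (\<xi>, \<eta>) = 0"
proof -
  obtain xs where "t = (\<Sum>(a, b)\<leftarrow>xs. tensor scale a b)" using assms(1) by (rule tensor_spaceE)
  moreover have "(\<Sum>(a, b)\<leftarrow>xs. tensor scale a b) (\<xi>, \<eta>) = 0"
    using assms(2) by (induction xs) (auto simp: tensor_def)
  ultimately show ?thesis by simp
qed

text \<open>If evaluating \<open>f a b\<close> at \<open>x\<close> factors as
  \<open>\<xi> a * \<eta> b\<close>, then evaluation after lifting is the linear functional \<xi>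
  tensor \<eta> on \<open>t\<close>, and the encoding of tensors makes this the value of
  \<open>t\<close> at that pair.\<close>

lemma tensor_lift_eval:
  assumes t: "t \<in> tensor_space scale"
    and f: "bilinear_on scale UNIV scale UNIV fun_scale UNIV f"
    and fx: "\<And>a b. f a b x = \<xi> a * \<eta> b"
    and dual: "\<xi> \<in> dual_space scale" "\<eta> \<in> dual_space scale"
  shows "tensor_lift scale f t x = t (\<xi>, \<eta>)"
proof -
  obtain xs where xs: "t = (\<Sum>(a, b)\<leftarrow>xs. tensor scale a b)" using t by (rule tensor_spaceE)
  have "(\<Sum>(a, b)\<leftarrow>xs. f a b) x = (\<Sum>(a, b)\<leftarrow>xs. tensor scale a b) (\<xi>, \<eta>)"
    by (induction xs) (auto simp: tensor_def fx dual)
  then show ?thesis by (simp add: xs tensor_lift_sum[OF vector_space_fun_scale f])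
qed

lemma tensor_lift_eval_zero:
  assumes t: "t \<in> tensor_space scale"
    and f: "bilinear_on scale UNIV scale UNIV fun_scale UNIV f"
    and fx: "\<And>a b. f a b x = 0"
  shows "tensor_lift scale f t x = 0"
proof -
  obtain xs where xs: "t = (\<Sum>(a, b)\<leftarrow>xs. tensor scale a b)" using t by (rule tensor_spaceE)
  have "(\<Sum>(a, b)\<leftarrow>xs. f a b) x = 0"
    by (induction xs) (auto simp: fx)
  then show ?thesis by (simp add: xs tensor_lift_sum[OF vector_space_fun_scale f])
qed

lemma
  assumes t: "t \<in> tensor_space scale" and \<zeta>: "\<zeta> \<in> dual_space scale"
    and \<xi>: "\<xi> \<in> dual_space scale" and \<eta>: "\<eta> \<in> dual_space scale"
  shows tensor_add_left: "t (\<xi> + \<eta>, \<zeta>) = t (\<xi>, \<zeta>) + t (\<eta>, \<zeta>)"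
    and tensor_add_right: "t (\<zeta>, \<xi> + \<eta>) = t (\<zeta>, \<xi>) + t (\<zeta>, \<eta>)"
proof -
  obtain xs where xs: "t = (\<Sum>(a, b)\<leftarrow>xs. tensor scale a b)" using t by (rule tensor_spaceE)
  have "(\<lambda>a. \<xi> a + \<eta> a) \<in> dual_space scale" using add_in_dual[OF \<xi> \<eta>] by (simp add: plus_fun_def)
  note d = \<xi> \<eta> \<zeta> this
  show "t (\<xi> + \<eta>, \<zeta>) = t (\<xi>, \<zeta>) + t (\<eta>, \<zeta>)"
    unfolding xs by (induction xs) (auto simp: tensor_def d ring_distribs)
  show "t (\<zeta>, \<xi> + \<eta>) = t (\<zeta>, \<xi>) + t (\<zeta>, \<eta>)"
    unfolding xs by (induction xs) (auto simp: tensor_def d ring_distribs)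
qed

lemma
  assumes t: "t \<in> tensor_space scale" and \<zeta>: "\<zeta> \<in> dual_space scale" and \<xi>: "\<xi> \<in> dual_space scale"
  shows tensor_scale_left: "t (fun_scale c \<xi>, \<zeta>) = c * t (\<xi>, \<zeta>)"
    and tensor_scale_right: "t (\<zeta>, fun_scale c \<xi>) = c * t (\<zeta>, \<xi>)"
proof -
  obtain xs where xs: "t = (\<Sum>(a, b)\<leftarrow>xs. tensor scale a b)" using t by (rule tensor_spaceE)
  have "(\<lambda>a. c * \<xi> a) \<in> dual_space scale" using scale_in_dual[OF \<xi>] by (simp add: fun_scale_def)
  note d = \<xi> \<zeta> this
  show "t (fun_scale c \<xi>, \<zeta>) = c * t (\<xi>, \<zeta>)"
    unfolding xs by (induction xs) (auto simp: tensor_def fun_scale_def d algebra_simps)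
  show "t (\<zeta>, fun_scale c \<xi>) = c * t (\<zeta>, \<xi>)"
    unfolding xs by (induction xs) (auto simp: tensor_def fun_scale_def d algebra_simps)
qed

lemma tensor_diff_left:
  assumes "t \<in> tensor_space scale" "\<zeta> \<in> dual_space scale" "\<xi> \<in> dual_space scale"
    "\<eta> \<in> dual_space scale"
  shows "t (\<xi> - \<eta>, \<zeta>) = t (\<xi>, \<zeta>) - t (\<eta>, \<zeta>)"
  using tensor_add_left[OF assms(1,2) diff_in_dual[OF assms(3,4)] assms(4)] by simp

lemma tensor_diff_right:
  assumes "t \<in> tensor_space scale" "\<zeta> \<in> dual_space scale" "\<xi> \<in> dual_space scale"
    "\<eta> \<in> dual_space scale"
  shows "t (\<zeta>, \<xi> - \<eta>) = t (\<zeta>, \<xi>) - t (\<zeta>, \<eta>)"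
  using tensor_add_right[OF assms(1,2) diff_in_dual[OF assms(3,4)] assms(4)] by simp

lemma tensor_pairing_eval:
  assumes t: "t \<in> tensor_space scale" and \<xi>: "\<xi> \<in> dual_space scale" and \<eta>: "\<eta> \<in> dual_space scale"
  shows "tensor_pairing scale \<xi> \<eta> t = t (\<xi>, \<eta>)"
proof -
  obtain xs where xs: "t = (\<Sum>(a, b)\<leftarrow>xs. tensor scale a b)" using t by (rule tensor_spaceE)
  have f: "bilinear_on scale UNIV scale UNIV (*) UNIV (\<lambda>a b. \<xi> a * \<eta> b)"
    using \<xi> \<eta> by (auto simp: bilinear_on_def linear_on_def dual_space_iff algebra_simps)
  have "vector_space ((*) :: 'a \<Rightarrow> _)" by unfold_locales (auto simp: algebra_simps)
  moreover have "(\<Sum>(a, b)\<leftarrow>xs. \<xi> a * \<eta> b) = (\<Sum>(a, b)\<leftarrow>xs. tensor scale a b) (\<xi>, \<eta>)"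
    by (induction xs) (auto simp: tensor_def \<xi> \<eta>)
  ultimately show ?thesis unfolding tensor_pairing_def xs by (simp add: tensor_lift_sum[OF _ f])
qed

section \<open>Maps on tensor squares as precomposition of functionals\<close>

lemma bilinear_tensor_comp:
  assumes f: "linear_on scale UNIV scale UNIV f" and g: "linear_on scale UNIV scale UNIV g"
  shows "bilinear_on scale UNIV scale UNIV fun_scale UNIV (\<lambda>a b. tensor scale (f a) (g b))"
    and "bilinear_on scale UNIV scale UNIV fun_scale UNIV (\<lambda>a b. tensor scale (f b) (g a))"
  using f g
  by (auto simp: bilinear_on_def linear_on_def tensor_def fun_scale_def fun_eq_iff dual_space_iff
      algebra_simps)

lemma tensor_map_eval:
  assumes t: "t \<in> tensor_space scale"
    and f: "linear_on scale UNIV scale UNIV f" and g: "linear_on scale UNIV scale UNIV g"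
  shows "tensor_map scale f g t (\<xi>, \<eta>) =
    (if \<xi> \<in> dual_space scale \<and> \<eta> \<in> dual_space scale then t (\<lambda>a. \<xi> (f a), \<lambda>b. \<eta> (g b)) else 0)"
proof (cases "\<xi> \<in> dual_space scale \<and> \<eta> \<in> dual_space scale")
  case True
  then show ?thesis unfolding tensor_map_def
    by (subst tensor_lift_eval[OF t bilinear_tensor_comp(1)[OF f g],
          where \<xi> = "\<lambda>a. \<xi> (f a)" and \<eta> = "\<lambda>b. \<eta> (g b)"])
       (auto simp: tensor_def comp_in_dual f g)
next
  case False
  then show ?thesis unfolding tensor_map_def
    by (subst tensor_lift_eval_zero[OF t bilinear_tensor_comp(1)[OF f g]]) (auto simp: tensor_def)
qed

lemma tensor_swap_eval:
  assumes t: "t \<in> tensor_space scale"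
  shows "tensor_swap scale t (\<xi>, \<eta>) = t (\<eta>, \<xi>)"
proof -
  have id: "linear_on scale UNIV scale UNIV (\<lambda>x. x)" by (simp add: linear_on_def)
  show ?thesis
  proof (cases "\<xi> \<in> dual_space scale \<and> \<eta> \<in> dual_space scale")
    case True
    then show ?thesis unfolding tensor_swap_def
      by (subst tensor_lift_eval[OF t bilinear_tensor_comp(2)[OF id id], where \<xi> = \<eta> and \<eta> = \<xi>])
         (auto simp: tensor_def)
  next
    case False
    then show ?thesis unfolding tensor_swap_def
      by (subst tensor_lift_eval_zero[OF t bilinear_tensor_comp(2)[OF id id]])
         (auto simp: tensor_def tensor_space_outside_dual[OF t])
  qed
qed

lemma tensor_lift_in_tensor_space:
  assumes t: "t \<in> tensor_space scale"
    and f: "bilinear_on scale UNIV scale UNIV fun_scale UNIV (\<lambda>a b. tensor scale (f a b) (g a b))"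
  shows "tensor_lift scale (\<lambda>a b. tensor scale (f a b) (g a b)) t \<in> tensor_space scale"
proof -
  obtain xs where xs: "t = (\<Sum>(a, b)\<leftarrow>xs. tensor scale a b)" using t by (rule tensor_spaceE)
  have "(\<Sum>(a, b)\<leftarrow>xs. tensor scale (f a b) (g a b)) =
      (\<Sum>(a, b)\<leftarrow>map (\<lambda>(a, b). (f a b, g a b)) xs. tensor scale a b)"
    by (simp add: case_prod_unfold comp_def)
  then show ?thesis
    unfolding xs tensor_lift_sum[OF vector_space_fun_scale f]
      tensor_space_eq_sums[OF vector_space_axioms]
    by (rule range_eqI)
qed

lemma tensor_map_in_tensor_space:
  assumes "t \<in> tensor_space scale"
    and "linear_on scale UNIV scale UNIV f" "linear_on scale UNIV scale UNIV g"
  shows "tensor_map scale f g t \<in> tensor_space scale"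
  unfolding tensor_map_def
  by (rule tensor_lift_in_tensor_space[OF assms(1) bilinear_tensor_comp(1)[OF assms(2,3)]])

lemma tensor_swap_in_tensor_space:
  assumes "t \<in> tensor_space scale"
  shows "tensor_swap scale t \<in> tensor_space scale"
  unfolding tensor_swap_def
  by (rule tensor_lift_in_tensor_space[OF assms bilinear_tensor_comp(2)[of "\<lambda>x. x" "\<lambda>x. x"]])
     (simp_all add: linear_on_def)

lemma tensor_space_diff:
  assumes "s \<in> tensor_space scale" "t \<in> tensor_space scale"
  shows "s - t \<in> tensor_space scale"
proof -
  interpret F: vector_space "fun_scale :: 'a \<Rightarrow> (('b \<Rightarrow> 'a) \<times> ('b \<Rightarrow> 'a) \<Rightarrow> 'a) \<Rightarrow> _"
    by (rule vector_space_fun_scale)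
  show ?thesis using assms unfolding tensor_space_def by (rule F.span_diff)
qed

end

locale finite_dimensional_coproduct = finite_dimensional_vector_space scale Basis
  for scale :: "'k::field \<Rightarrow> 'a::ab_group_add \<Rightarrow> 'a" and Basis :: "'a set" +
  fixes \<Delta> :: "'a \<Rightarrow> ('a, 'k) tensor2"
  assumes linear_coproduct: "linear_on scale UNIV fun_scale (tensor_space scale) \<Delta>"
begin

lemma coproduct_in_tensor_space [simp]: "\<Delta> a \<in> tensor_space scale"
  using linear_coproduct by (simp add: linear_on_def)

lemma coproduct_add: "\<Delta> (a + b) = \<Delta> a + \<Delta> b"
  using linear_coproduct by (simp add: linear_on_def)

lemma coproduct_scale: "\<Delta> (scale c a) = fun_scale c (\<Delta> a)"
  using linear_coproduct by (simp add: linear_on_def)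

lemma coproduct_eval_in_dual: "(\<lambda>a. \<Delta> a (\<xi>, \<eta>)) \<in> dual_space scale"
  by (simp add: dual_space_iff coproduct_add coproduct_scale fun_scale_def)

lemma dual_product_eval:
  assumes "\<xi> \<in> dual_space scale" "\<eta> \<in> dual_space scale"
  shows "dual_product scale \<Delta> \<xi> \<eta> = (\<lambda>a. \<Delta> a (\<xi>, \<eta>))"
  using assms by (simp add: dual_product_def tensor_pairing_eval)

section \<open>Threefold tensors and the coalgebra identity\<close>

lemma bilinear_tensor3:
  "bilinear_on scale UNIV scale UNIV fun_scale UNIV (\<lambda>b c. tensor3 scale a b c)"
  "bilinear_on scale UNIV scale UNIV fun_scale UNIV (\<lambda>a b. tensor3 scale a b c)"
  by (auto simp: bilinear_on_def linear_on_def tensor3_def fun_scale_def fun_eq_iff dual_space_iff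
      algebra_simps)

lemma tensor_lift_tensor3_left:
  "tensor_lift scale (\<lambda>c d. tensor3 scale c d b) (\<Delta> a) (\<xi>, \<eta>, \<zeta>) =
    (if \<zeta> \<in> dual_space scale then \<Delta> a (\<xi>, \<eta>) * \<zeta> b else 0)"
proof (cases "\<xi> \<in> dual_space scale \<and> \<eta> \<in> dual_space scale \<and> \<zeta> \<in> dual_space scale")
  case True
  \<comment> \<open>The scalar \<open>\<zeta> b\<close> is absorbed into \<open>\<eta>\<close>,
    which gives the product of two functionals that \<open>tensor_lift_eval\<close> expects;
    linearity of \<open>\<Delta> a\<close> in its second argument takes it out again.\<close>
  then have "tensor_lift scale (\<lambda>c d. tensor3 scale c d b) (\<Delta> a) (\<xi>, \<eta>, \<zeta>)
      = \<Delta> a (\<xi>, fun_scale (\<zeta> b) \<eta>)"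
    by (intro tensor_lift_eval bilinear_tensor3 scale_in_dual)
       (auto simp: tensor3_def fun_scale_def)
  then show ?thesis using True by (simp add: tensor_scale_right)
next
  case False
  then have "tensor_lift scale (\<lambda>c d. tensor3 scale c d b) (\<Delta> a) (\<xi>, \<eta>, \<zeta>) = 0"
    by (intro tensor_lift_eval_zero bilinear_tensor3) (auto simp: tensor3_def)
  with False show ?thesis by (auto simp: tensor_space_outside_dual)
qed

lemma tensor_lift_tensor3_right:
  "tensor_lift scale (\<lambda>c d. tensor3 scale a c d) (\<Delta> b) (\<xi>, \<eta>, \<zeta>) =
    (if \<xi> \<in> dual_space scale then \<xi> a * \<Delta> b (\<eta>, \<zeta>) else 0)"
proof (cases "\<xi> \<in> dual_space scale \<and> \<eta> \<in> dual_space scale \<and> \<zeta> \<in> dual_space scale")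
  case True
  then have "tensor_lift scale (\<lambda>c d. tensor3 scale a c d) (\<Delta> b) (\<xi>, \<eta>, \<zeta>)
      = \<Delta> b (fun_scale (\<xi> a) \<eta>, \<zeta>)"
    by (intro tensor_lift_eval bilinear_tensor3 scale_in_dual)
       (auto simp: tensor3_def fun_scale_def)
  then show ?thesis using True by (simp add: tensor_scale_left)
next
  case False
  then have "tensor_lift scale (\<lambda>c d. tensor3 scale a c d) (\<Delta> b) (\<xi>, \<eta>, \<zeta>) = 0"
    by (intro tensor_lift_eval_zero bilinear_tensor3) (auto simp: tensor3_def)
  with False show ?thesis by (auto simp: tensor_space_outside_dual)
qed

lemma bilinear_coprod_tensor_id:
  "bilinear_on scale UNIV scale UNIV fun_scale UNIV
    (\<lambda>a b. tensor_lift scale (\<lambda>c d. tensor3 scale c d b) (\<Delta> a))"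
  by (rule bilinear_on_functions; case_tac x)
     (auto simp: tensor_lift_tensor3_left dual_space_iff coproduct_add coproduct_scale fun_scale_def
       algebra_simps)

lemma bilinear_id_tensor_coprod:
  "bilinear_on scale UNIV scale UNIV fun_scale UNIV
    (\<lambda>a b. tensor_lift scale (\<lambda>c d. tensor3 scale a c d) (\<Delta> b))"
  by (rule bilinear_on_functions; case_tac x)
     (auto simp: tensor_lift_tensor3_right dual_space_iff coproduct_add coproduct_scale fun_scale_def
       algebra_simps)

lemma coprod_tensor_id_eval:
  assumes "t \<in> tensor_space scale" "\<zeta> \<in> dual_space scale"
  shows "coprod_tensor_id scale \<Delta> t (\<xi>, \<eta>, \<zeta>) = t (\<lambda>a. \<Delta> a (\<xi>, \<eta>), \<zeta>)"
  unfolding coprod_tensor_id_def using assms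
  by (intro tensor_lift_eval bilinear_coprod_tensor_id coproduct_eval_in_dual)
     (simp_all add: tensor_lift_tensor3_left)

lemma id_tensor_coprod_eval:
  assumes "t \<in> tensor_space scale" "\<xi> \<in> dual_space scale"
  shows "id_tensor_coprod scale \<Delta> t (\<xi>, \<eta>, \<zeta>) = t (\<xi>, \<lambda>a. \<Delta> a (\<eta>, \<zeta>))"
  unfolding id_tensor_coprod_def using assms
  by (intro tensor_lift_eval bilinear_id_tensor_coprod coproduct_eval_in_dual)
     (simp_all add: tensor_lift_tensor3_right)

text \<open>The swap on threefold tensors is computable only on sums of pure tensors, so an explicit
  list is produced for the tensors to which the coalgebra identity applies it.\<close>

lemma id_tensor_coprod_sum_of_pure:
  assumes t: "t \<in> tensor_space scale"
  obtains ys where "id_tensor_coprod scale \<Delta> t = (\<Sum>(a, b, c)\<leftarrow>ys. tensor3 scale a b c)"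
proof -
  let ?f = "\<lambda>a b. tensor_lift scale (\<lambda>c d. tensor3 scale a c d) (\<Delta> b)"
  have f: "\<exists>ys. ?f a b = (\<Sum>(a, b, c)\<leftarrow>ys. tensor3 scale a b c)" for a b
  proof -
    obtain xs where xs: "\<Delta> b = (\<Sum>(a, b)\<leftarrow>xs. tensor scale a b)"
      using tensor_spaceE[OF coproduct_in_tensor_space] by metis
    have "?f a b = (\<Sum>(c, d)\<leftarrow>xs. tensor3 scale a c d)"
      unfolding xs by (rule tensor_lift_sum[OF vector_space_fun_scale bilinear_tensor3(1)])
    also have "\<dots> = (\<Sum>(a, b, c)\<leftarrow>map (\<lambda>(c, d). (a, c, d)) xs. tensor3 scale a b c)"
      by (simp add: case_prod_unfold comp_def)
    finally show ?thesis by blast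
  qed
  obtain xs where xs: "t = (\<Sum>(a, b)\<leftarrow>xs. tensor scale a b)" using t by (rule tensor_spaceE)
  have "\<exists>ys. (\<Sum>(a, b)\<leftarrow>xs. ?f a b) = (\<Sum>(a, b, c)\<leftarrow>ys. tensor3 scale a b c)"
  proof (induction xs)
    case Nil
    show ?case by (rule exI[of _ "[]"]) simp
  next
    case (Cons p xs)
    obtain ys where ys: "(\<Sum>(a, b)\<leftarrow>xs. ?f a b) = (\<Sum>(a, b, c)\<leftarrow>ys. tensor3 scale a b c)"
      using Cons.IH by blast
    obtain zs where zs: "?f (fst p) (snd p) = (\<Sum>(a, b, c)\<leftarrow>zs. tensor3 scale a b c)"
      using f by blast
    show ?case using ys zs
      by (intro exI[of _ "zs @ ys"]) (simp add: case_prod_unfold del: plus_fun_def)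
  qed
  then show thesis
    using that unfolding id_tensor_coprod_def xs
      tensor_lift_sum[OF vector_space_fun_scale bilinear_id_tensor_coprod] by blast
qed

lemma swap_tensor_id_eval:
  assumes \<xi>: "\<xi> \<in> dual_space scale" and \<eta>: "\<eta> \<in> dual_space scale" and \<zeta>: "\<zeta> \<in> dual_space scale"
  shows "swap_tensor_id scale (\<Sum>(a, b, c)\<leftarrow>ys. tensor3 scale a b c) (\<xi>, \<eta>, \<zeta>)
    = (\<Sum>(a, b, c)\<leftarrow>ys. tensor3 scale a b c) (\<eta>, \<xi>, \<zeta>)"
proof -
  have "swap_tensor_id scale (\<Sum>(a, b, c)\<leftarrow>ys. tensor3 scale a b c)
      = (\<Sum>(a, b, c)\<leftarrow>ys. tensor3 scale b a c)"
    unfolding swap_tensor_id_def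
    by (rule tensor3_lift_sum[OF vector_space_fun_scale])
       (auto simp: linear_on_def tensor3_def fun_scale_def fun_eq_iff dual_space_iff algebra_simps)
  moreover have "(\<Sum>(a, b, c)\<leftarrow>ys. tensor3 scale b a c) (\<xi>, \<eta>, \<zeta>)
    = (\<Sum>(a, b, c)\<leftarrow>ys. tensor3 scale a b c) (\<eta>, \<xi>, \<zeta>)"
    by (induction ys) (auto simp: tensor3_def \<xi> \<eta> \<zeta> algebra_simps)
  ultimately show ?thesis by simp
qed

text \<open>Evaluated at (\<xi>, \<eta>, \<zeta>), the three summands of the coalgebra identity
  become the products (\<xi>\<eta>)\<zeta>, \<xi>(\<eta>\<zeta>) and \<eta>(\<xi>\<zeta>); the swap
  accounts for the exchange of \<xi> and \<eta> in the last one.\<close>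

lemma dual_product_anti_leibniz:
  assumes "anti_leibniz_coalgebra scale \<Delta>"
  shows "anti_leibniz_algebra fun_scale (dual_space scale) (dual_product scale \<Delta>)"
  unfolding anti_leibniz_algebra_def
proof (intro conjI ballI subspace_dual)
  show "bilinear_on fun_scale (dual_space scale) fun_scale (dual_space scale) fun_scale
      (dual_space scale) (dual_product scale \<Delta>)"
    by (auto simp: bilinear_on_def linear_on_def dual_product_eval coproduct_eval_in_dual
        add_in_dual scale_in_dual tensor_add_left tensor_add_right tensor_scale_left
        tensor_scale_right fun_eq_iff)
       (simp_all add: fun_scale_def)
  fix \<xi> \<eta> \<zeta>
  assume d: "\<xi> \<in> dual_space scale" "\<eta> \<in> dual_space scale" "\<zeta> \<in> dual_space scale"
  let ?p = "dual_product scale \<Delta>"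
  show "?p \<xi> (?p \<eta> \<zeta>) + ?p (?p \<xi> \<eta>) \<zeta> + ?p \<eta> (?p \<xi> \<zeta>) = 0"
  proof
    fix a
    obtain ys where ys: "id_tensor_coprod scale \<Delta> (\<Delta> a) = (\<Sum>(a, b, c)\<leftarrow>ys. tensor3 scale a b c)"
      using id_tensor_coprod_sum_of_pure[OF coproduct_in_tensor_space] by metis
    have "swap_tensor_id scale (id_tensor_coprod scale \<Delta> (\<Delta> a)) (\<xi>, \<eta>, \<zeta>)
        = \<Delta> a (\<eta>, \<lambda>a. \<Delta> a (\<xi>, \<zeta>))"
      using swap_tensor_id_eval[OF d, of ys] id_tensor_coprod_eval[of "\<Delta> a" \<eta> \<xi> \<zeta>] d
      by (simp add: ys)
    moreover have "(coprod_tensor_id scale \<Delta> (\<Delta> a) + id_tensor_coprod scale \<Delta> (\<Delta> a)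
        + swap_tensor_id scale (id_tensor_coprod scale \<Delta> (\<Delta> a))) (\<xi>, \<eta>, \<zeta>) = 0"
      using assms by (simp only: anti_leibniz_coalgebra_def zero_fun_def)
    ultimately show "(?p \<xi> (?p \<eta> \<zeta>) + ?p (?p \<xi> \<eta>) \<zeta> + ?p \<eta> (?p \<xi> \<zeta>)) a = 0 a"
      using d by (simp add: dual_product_eval coproduct_eval_in_dual coprod_tensor_id_eval
          id_tensor_coprod_eval add.commute add.left_commute)
  qed
qed

end

section \<open>The double of a bialgebra\<close>

locale dual_pair = finite_dimensional_coproduct scale Basis \<Delta>
  for scale :: "'k::field \<Rightarrow> 'a::ab_group_add \<Rightarrow> 'a" and Basis :: "'a set"
    and \<Delta> :: "'a \<Rightarrow> ('a, 'k) tensor2" +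
  fixes m :: "'a \<Rightarrow> 'a \<Rightarrow> 'a"
  assumes algebra: "anti_leibniz_algebra scale UNIV m"
    and coalgebra: "anti_leibniz_coalgebra scale \<Delta>"
begin

abbreviation "D \<equiv> dual_space scale"
abbreviation "mD \<equiv> dual_product scale \<Delta>"
abbreviation "L \<equiv> codual_rep scale (left_mult mD)"
abbreviation "R \<equiv> codual_rep scale (right_mult mD)"

section \<open>The two products and their coadjoint actions\<close>

lemma bilinear_m: "bilinear_on scale UNIV scale UNIV scale UNIV m"
  using algebra by (simp add: anti_leibniz_algebra_def)

lemma bilinear_mD: "bilinear_on fun_scale D fun_scale D fun_scale D mD"
  using dual_product_anti_leibniz[OF coalgebra] by (simp add: anti_leibniz_algebra_def)

lemmas m_linear = bilinear_onD[OF bilinear_m, OF UNIV_I UNIV_I, simplified]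

lemma m_zero [simp]: "m 0 a = 0" "m a 0 = 0"
  using bilinear_on_zero[OF bilinear_m] by simp_all

lemma m_minus: "m (- a) b = - m a b"
  using bilinear_onD(2)[OF bilinear_m, of a b "- a"] by (simp add: eq_neg_iff_add_eq_0 add.commute)

lemma linear_mult: "linear_on scale UNIV scale UNIV (left_mult m a)"
  "linear_on scale UNIV scale UNIV (right_mult m a)"
  by (simp_all add: linear_on_def left_mult_def right_mult_def m_linear)

lemma comp_mult_in_dual:
  assumes "\<xi> \<in> D"
  shows "(\<lambda>x. \<xi> (m a x)) \<in> D" "(\<lambda>x. \<xi> (m x a)) \<in> D"
  using comp_in_dual[OF assms linear_mult(1)[of a]] comp_in_dual[OF assms linear_mult(2)[of a]]
  by (simp_all add: left_mult_def right_mult_def)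

text \<open>Functionals separate vectors, so this formula and its transpose \<open>dual_R\<close>
  carry all the information about \<open>L\<close> and \<open>R\<close> used in the computations
  below.\<close>

lemma dual_L:
  assumes "\<xi> \<in> D" "\<eta> \<in> D"
  shows "\<eta> (L \<xi> a) = \<Delta> a (\<xi>, \<eta>)"
proof -
  have "linear_on fun_scale D fun_scale D (left_mult mD \<xi>)"
    using bilinear_mD assms(1) by (simp add: bilinear_on_def left_mult_def[abs_def])
  then have "\<eta> (L \<xi> a) = left_mult mD \<xi> \<eta> a"
    by (rule codual_rep_pairing[OF _ assms(2)])
  with assms show ?thesis by (simp add: left_mult_def dual_product_eval)
qed

lemma dual_R:
  assumes "\<xi> \<in> D" "\<eta> \<in> D"
  shows "\<eta> (R \<xi> a) = \<Delta> a (\<eta>, \<xi>)"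
proof -
  have "linear_on fun_scale D fun_scale D (right_mult mD \<xi>)"
    using bilinear_mD assms(1) by (simp add: bilinear_on_def right_mult_def[abs_def])
  then have "\<eta> (R \<xi> a) = right_mult mD \<xi> \<eta> a"
    by (rule codual_rep_pairing[OF _ assms(2)])
  with assms show ?thesis by (simp add: right_mult_def dual_product_eval)
qed

lemma bilinear_dual_rep:
  "bilinear_on scale UNIV fun_scale D fun_scale D (dual_rep (left_mult m))"
  "bilinear_on scale UNIV fun_scale D fun_scale D (dual_rep (left_mult m) - dual_rep (right_mult m))"
  by (auto simp: bilinear_on_def linear_on_def dual_rep_def left_mult_def right_mult_def
      comp_mult_in_dual diff_in_dual m_linear dual_add dual_scale fun_eq_iff
      fun_scale_def algebra_simps)

lemma bilinear_codual_rep: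
  "bilinear_on fun_scale D scale UNIV scale UNIV L"
  "bilinear_on fun_scale D scale UNIV scale UNIV (L - R)"
proof -
  have L: "L \<xi> (a + b) = L \<xi> a + L \<xi> b" "L \<xi> (scale c a) = scale c (L \<xi> a)"
    "L (\<xi> + \<eta>) a = L \<xi> a + L \<eta> a" "L (fun_scale c \<xi>) a = scale c (L \<xi> a)"
    and R: "R \<xi> (a + b) = R \<xi> a + R \<xi> b" "R \<xi> (scale c a) = scale c (R \<xi> a)"
    "R (\<xi> + \<eta>) a = R \<xi> a + R \<eta> a" "R (fun_scale c \<xi>) a = scale c (R \<xi> a)"
    if "\<xi> \<in> D" "\<eta> \<in> D" for \<xi> \<eta> a b c
    using that
    by (auto intro!: dual_separates simp del: plus_fun_apply
        simp: dual_L dual_R dual_add dual_scale add_in_dual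
        scale_in_dual tensor_add_left tensor_add_right tensor_scale_left tensor_scale_right
        coproduct_add coproduct_scale)
       (simp_all add: fun_scale_def)
  show "bilinear_on fun_scale D scale UNIV scale UNIV L"
    using zero_in_dual by (auto simp: bilinear_on_def linear_on_def L)
  show "bilinear_on fun_scale D scale UNIV scale UNIV (L - R)"
    using zero_in_dual by (auto simp: bilinear_on_def linear_on_def L R scale_right_diff_distrib)
qed

sublocale bowtie scale UNIV fun_scale D m mD "dual_rep (left_mult m)"
  "dual_rep (left_mult m) - dual_rep (right_mult m)" L "L - R"
  by unfold_locales
     (intro algebra dual_product_anti_leibniz[OF coalgebra] bilinear_dual_rep bilinear_codual_rep)+

lemma q_eq:
  "q (a, \<xi>) (b, \<eta>) = (m a b + L \<xi> b + (L \<eta> a - R \<eta> a),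
    mD \<xi> \<eta> + (\<lambda>x. \<eta> (m a x)) + ((\<lambda>x. \<xi> (m b x)) - (\<lambda>x. \<xi> (m x b))))"
  by (simp add: bowtie_product_def dual_rep_def left_mult_def right_mult_def)

text \<open>One factor keeps both components because the inner products in
  \<open>J (0, \<xi>) (a, 0) (b, 0)\<close> already have both.\<close>

lemma q_mixed:
  assumes "\<zeta> \<in> D"
  shows "q (c, \<zeta>) (b, 0) = (m c b + L \<zeta> b, \<lambda>x. \<zeta> (m b x) - \<zeta> (m x b))"
    and "q (b, 0) (c, \<zeta>) = (m b c + (L \<zeta> b - R \<zeta> b), \<lambda>x. \<zeta> (m b x))"
proof -
  have "L 0 a = 0" "R 0 a = 0" "mD \<zeta> 0 = 0" "mD 0 \<zeta> = 0" for a
    using assms zero_in_dual bilinear_on_zero[OF bilinear_mD]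
      bilinear_on_zero(1)[OF bilinear_codual_rep(1)] bilinear_on_zero(1)[OF bilinear_codual_rep(2)]
    by simp_all
  then show "q (c, \<zeta>) (b, 0) = (m c b + L \<zeta> b, \<lambda>x. \<zeta> (m b x) - \<zeta> (m x b))"
    "q (b, 0) (c, \<zeta>) = (m b c + (L \<zeta> b - R \<zeta> b), \<lambda>x. \<zeta> (m b x))"
    by (simp_all add: q_eq fun_eq_iff)
qed

lemma double_scale_eq: "double_scale scale = (\<lambda>c (a, \<xi>). (scale c a, fun_scale c \<xi>))"
  by (simp add: double_scale_def fun_eq_iff)

section \<open>The canonical skew form on the double\<close>

lemma double_form_add_left:
  assumes "x \<in> UNIV \<times> D" "y \<in> UNIV \<times> D" "z \<in> UNIV \<times> D"
  shows "double_form (x + y) z = double_form x z + double_form y z"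
  using assms by (auto simp: double_form_def dual_add)

lemma double_form_skew: "double_form x y = - double_form y (x :: 'a \<times> ('a \<Rightarrow> 'k))"
  by (simp add: double_form_def split: prod.split)

lemma double_form_nondegenerate:
  assumes "x \<in> UNIV \<times> D" "\<And>y. y \<in> UNIV \<times> D \<Longrightarrow> double_form x y = 0"
  shows "x = 0"
proof -
  obtain a \<xi> where x: "x = (a, \<xi>)" by force
  have "\<xi> b = 0" for b
    using assms(2)[of "(b, 0)"] by (simp add: double_form_def x zero_in_dual)
  moreover have "a = 0"
  proof (rule dual_separates)
    fix \<eta> assume "\<eta> \<in> D"
    then have "\<xi> 0 - \<eta> a = 0"
      using assms(2)[of "(0, \<eta>)"] by (simp add: double_form_def x)
    then show "\<eta> a = \<eta> 0"
      using assms(1) \<open>\<eta> \<in> D\<close> by (simp add: x dual_zero)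
  qed
  ultimately show ?thesis by (simp add: x zero_prod_def fun_eq_iff)
qed

lemma double_decomp:
  fixes x :: "'a \<times> ('a \<Rightarrow> 'k)"
  assumes "x \<in> UNIV \<times> D"
  shows "\<exists>u\<in>UNIV \<times> {0}. \<exists>w\<in>{0} \<times> D. x = u + w"
proof -
  obtain a \<xi> where x: "x = (a, \<xi>)" by force
  show ?thesis
  proof (intro bexI)
    show "x = (a, 0) + (0, \<xi>)" by (simp add: x)
  qed (use assms x in auto)
qed

text \<open>Here the choice of actions pays off: \<open>dual_L\<close> and \<open>dual_R\<close>
  turn every mixed term into a value of \<Delta> or of a functional on a product in
  \<open>A\<close>, and both sides become the same scalar sum.\<close>

sublocale invariant_product "UNIV \<times> D" q double_form
proof
  show "invariant_form (UNIV \<times> D) q double_form"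
    unfolding invariant_form_def
  proof clarify
    fix a b c and \<xi> \<eta> \<zeta> assume D: "\<xi> \<in> D" "\<eta> \<in> D" "\<zeta> \<in> D"
    show "double_form (q (a, \<xi>) (b, \<eta>)) (c, \<zeta>) =
        double_form (a, \<xi>) (q (b, \<eta>) (c, \<zeta>) - q (c, \<zeta>) (b, \<eta>))"
      using D
      by (simp add: q_eq double_form_def dual_add dual_diff dual_L dual_R dual_product_eval)
  qed
qed (fact double_form_add_left, rule double_form_skew)

lemma manin_triple_iff:
  "(\<exists>p. standard_manin_triple scale m mD p) \<longleftrightarrow>
    anti_leibniz_algebra (double_scale scale) (UNIV \<times> D) q"
proof
  assume "anti_leibniz_algebra (double_scale scale) (UNIV \<times> D) q"
  then show "\<exists>p. standard_manin_triple scale m mD p"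
    using algebra dual_product_anti_leibniz[OF coalgebra] form_invariant
    by (intro exI[of _ q]) (simp add: standard_manin_triple_def bowtie_pure zero_in_dual)
next
  assume "\<exists>p. standard_manin_triple scale m mD p"
  then obtain p where p: "standard_manin_triple scale m mD p" ..
  then have alg: "anti_leibniz_algebra (double_scale scale) (UNIV \<times> D) p"
    by (simp add: standard_manin_triple_def)
  then have bil: "bilinear_on (double_scale scale) (UNIV \<times> D) (double_scale scale) (UNIV \<times> D)
      (double_scale scale) (UNIV \<times> D) p" by (simp add: anti_leibniz_algebra_def)
  have inv: "invariant_product (UNIV \<times> D) p double_form"
  proof
    show "invariant_form (UNIV \<times> D) p double_form"
      using p by (simp add: standard_manin_triple_def)
  qed (rule add_closed diff_closed bilinear_onD(1-3)[OF bil] form_add_left form_skew; assumption)+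
  have eq: "p x y = q x y" if "x \<in> UNIV \<times> D" "y \<in> UNIV \<times> D" for x y
  proof (rule product_unique[OF inv _ _ double_decomp double_form_nondegenerate])
    show "p x y = q x y" if "x \<in> UNIV \<times> {0}" "y \<in> UNIV \<times> {0}" for x y
      using that p by (auto simp: standard_manin_triple_def bowtie_pure zero_in_dual)
    show "p x y = q x y" if "x \<in> {0} \<times> D" "y \<in> {0} \<times> D" for x y
      using that p by (auto simp: standard_manin_triple_def bowtie_pure)
  qed (use that zero_in_dual in auto)
  \<comment> \<open>The products \<open>p\<close> and \<open>q\<close> agree on the carrier only, so
    closure is what lets the rewriting reach the nested products.\<close>
  have "anti_leibnizator q x y z = 0" if "x \<in> UNIV \<times> D" "y \<in> UNIV \<times> D" "z \<in> UNIV \<times> D" for x y z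
  proof -
    have "p x (p y z) + p (p x y) z + p y (p x z) = 0"
      using alg that unfolding anti_leibniz_algebra_def by blast
    then show ?thesis using that by (simp only: anti_leibnizator_def eq closed)
  qed
  then show "anti_leibniz_algebra (double_scale scale) (UNIV \<times> D) q"
    unfolding double_scale_eq bowtie_anti_leibniz_iff by blast
qed

section \<open>The bialgebra conditions as scalar identities\<close>

lemma dual_mult_L:
  assumes "\<xi> \<in> D" "\<eta> \<in> D"
  shows "\<eta> (m (L \<xi> a) b) = \<Delta> a (\<xi>, \<lambda>x. \<eta> (m x b))" "\<eta> (m b (L \<xi> a)) = \<Delta> a (\<xi>, \<lambda>x. \<eta> (m b x))"
  using dual_L[OF assms(1) comp_mult_in_dual(2)[OF assms(2)]]
    dual_L[OF assms(1) comp_mult_in_dual(1)[OF assms(2)]] by simp_all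

lemma dual_mult_R:
  assumes "\<xi> \<in> D" "\<eta> \<in> D"
  shows "\<eta> (m (R \<xi> a) b) = \<Delta> a (\<lambda>x. \<eta> (m x b), \<xi>)"
  using dual_R[OF assms(1) comp_mult_in_dual(2)[OF assms(2)]] by simp

lemma bialgebra_iff:
  "anti_leibniz_bialgebra scale m \<Delta> \<longleftrightarrow> (\<forall>a b. \<forall>\<xi>\<in>D. \<forall>\<eta>\<in>D.
    \<Delta> (m a b) (\<xi>, \<eta>)
      + (\<Delta> a (\<xi>, \<lambda>x. \<eta> (m x b)) - \<Delta> a (\<lambda>x. \<eta> (m x b), \<xi>)
        - (\<Delta> a (\<lambda>x. \<xi> (m x b), \<eta>) - \<Delta> a (\<eta>, \<lambda>x. \<xi> (m x b)))
        + (\<Delta> a (\<lambda>x. \<xi> (m b x), \<eta>) - \<Delta> a (\<eta>, \<lambda>x. \<xi> (m b x))))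
      + (\<Delta> b (\<xi>, \<lambda>x. \<eta> (m a x)) + \<Delta> b (\<lambda>x. \<xi> (m a x), \<eta>)) = 0 \<and>
    \<Delta> b (\<lambda>x. \<xi> (m x a), \<eta>) - \<Delta> a (\<lambda>x. \<eta> (m x b), \<xi>) = 0)"
proof -
  have id: "linear_on scale UNIV scale UNIV id" by (simp add: linear_on_def)
  let ?swap = "tensor_swap scale" and ?map = "tensor_map scale"
  \<comment> \<open>Both axioms assert that a tensor is zero. Each term vanishes outside the dual,
    so testing on pairs from \<open>D\<close> is enough.\<close>
  have zero_iff: "X = 0 \<longleftrightarrow> (\<forall>\<xi>\<in>D. \<forall>\<eta>\<in>D. X (\<xi>, \<eta>) = 0)"
    if "\<And>\<xi> \<eta>. \<not> (\<xi> \<in> D \<and> \<eta> \<in> D) \<Longrightarrow> X (\<xi>, \<eta>) = 0" for X :: "('a, 'k) tensor2"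
    using that by (auto simp: fun_eq_iff)
  have map_id: "?map id id (\<Delta> a) - ?swap (\<Delta> a) \<in> tensor_space scale" for a
    by (intro tensor_space_diff tensor_map_in_tensor_space tensor_swap_in_tensor_space id
        coproduct_in_tensor_space)
  note eval = tensor_map_eval[OF map_id] tensor_map_eval[OF coproduct_in_tensor_space]
    tensor_swap_eval[OF coproduct_in_tensor_space]
    tensor_swap_eval[OF tensor_map_in_tensor_space[OF coproduct_in_tensor_space]]
    linear_mult id tensor_space_outside_dual[OF coproduct_in_tensor_space]
  have "(let u = ?map id id (\<Delta> a) - ?swap (\<Delta> a) in
          \<Delta> (m a b) + (?map id (right_mult m b) u - ?map (right_mult m b) id u
              + ?map (left_mult m b) id u)
          + (?map id (left_mult m a) (\<Delta> b) + ?map (left_mult m a) id (\<Delta> b)) = 0) \<longleftrightarrow>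
    (\<forall>\<xi>\<in>D. \<forall>\<eta>\<in>D. \<Delta> (m a b) (\<xi>, \<eta>)
      + (\<Delta> a (\<xi>, \<lambda>x. \<eta> (m x b)) - \<Delta> a (\<lambda>x. \<eta> (m x b), \<xi>)
        - (\<Delta> a (\<lambda>x. \<xi> (m x b), \<eta>) - \<Delta> a (\<eta>, \<lambda>x. \<xi> (m x b)))
        + (\<Delta> a (\<lambda>x. \<xi> (m b x), \<eta>) - \<Delta> a (\<eta>, \<lambda>x. \<xi> (m b x))))
      + (\<Delta> b (\<xi>, \<lambda>x. \<eta> (m a x)) + \<Delta> b (\<lambda>x. \<xi> (m a x), \<eta>)) = 0)" for a b
    unfolding Let_def
    by (subst zero_iff)
       (auto simp: eval comp_mult_in_dual left_mult_def right_mult_def)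
  moreover have "?map (right_mult m a) id (\<Delta> b) - ?swap (?map (right_mult m b) id (\<Delta> a)) = 0 \<longleftrightarrow>
    (\<forall>\<xi>\<in>D. \<forall>\<eta>\<in>D. \<Delta> b (\<lambda>x. \<xi> (m x a), \<eta>) - \<Delta> a (\<lambda>x. \<eta> (m x b), \<xi>) = 0)" for a b
    by (subst zero_iff)
       (auto simp: eval comp_mult_in_dual left_mult_def right_mult_def)
  ultimately show ?thesis
    using algebra coalgebra by (simp only: anti_leibniz_bialgebra_def) blast
qed

lemma bialgebra_iff_bowtie:
  "anti_leibniz_bialgebra scale m \<Delta> \<longleftrightarrow> anti_leibniz_algebra (double_scale scale) (UNIV \<times> D) q"
proof -
  \<comment> \<open>In the commutator of (0, \<xi>) and (a, 0) the left multiplications cancel,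
    leaving \<open>R \<xi> a\<close> and minus the functional sending \<open>x\<close> to
    \<open>\<xi> (m x a)\<close>. This is why \<open>C\<close> contains right multiplications only,
    exactly as in the second bialgebra axiom.\<close>
  have J: "double_form (J (0, \<xi>) (a, 0) (b, 0)) (0, \<eta>) =
      - (\<Delta> (m a b) (\<xi>, \<eta>) + \<Delta> a (\<xi>, \<lambda>x. \<eta> (m x b)) + \<Delta> b (\<xi>, \<lambda>x. \<eta> (m a x))
        + (\<Delta> b (\<lambda>x. \<xi> (m a x), \<eta>) - \<Delta> b (\<lambda>x. \<xi> (m x a), \<eta>))
        + (\<Delta> a (\<lambda>x. \<xi> (m b x), \<eta>) - \<Delta> a (\<lambda>x. \<xi> (m x b), \<eta>))
        - (\<Delta> a (\<eta>, \<lambda>x. \<xi> (m b x)) - \<Delta> a (\<eta>, \<lambda>x. \<xi> (m x b))))"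
    and C: "double_form (q (0, \<xi>) (a, 0) - q (a, 0) (0, \<xi>)) (q (b, 0) (0, \<eta>) - q (0, \<eta>) (b, 0)) =
      \<Delta> b (\<lambda>x. \<xi> (m x a), \<eta>) - \<Delta> a (\<lambda>x. \<eta> (m x b), \<xi>)"
    if "\<xi> \<in> D" "\<eta> \<in> D" for a b \<xi> \<eta>
    using that
    by (simp_all add: anti_leibnizator_def bowtie_pure(1) q_mixed m_zero double_form_def
        dual_zero dual_add dual_diff dual_minus dual_L dual_R dual_mult_L comp_mult_in_dual
        diff_in_dual[unfolded fun_diff_def] m_minus dual_mult_R
        tensor_diff_left[OF coproduct_in_tensor_space, unfolded fun_diff_def]
        tensor_diff_right[OF coproduct_in_tensor_space, unfolded fun_diff_def])
  have "anti_leibniz_algebra (double_scale scale) (UNIV \<times> D) q \<longleftrightarrow>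
    (\<forall>w\<in>{0} \<times> D. \<forall>u\<in>UNIV \<times> {0}. \<forall>u'\<in>UNIV \<times> {0}. \<forall>w'\<in>{0} \<times> D.
      double_form (J w u u') w' = 0 \<and> double_form (q w u - q u w) (q u' w' - q w' u') = 0)"
    unfolding double_scale_eq bowtie_anti_leibniz_iff
  proof (rule J_eq_0_iff[OF _ _ double_decomp double_form_nondegenerate])
    show "J x y z = 0" if "x \<in> UNIV \<times> {0}" "y \<in> UNIV \<times> {0}" "z \<in> UNIV \<times> {0}" for x y z
      using that anti_leibniz_A
      by (auto simp: anti_leibnizator_def bowtie_pure zero_in_dual zero_prod_def)
    show "J x y z = 0" if "x \<in> {0} \<times> D" "y \<in> {0} \<times> D" "z \<in> {0} \<times> D" for x y z
      using that anti_leibniz_B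
      by (auto simp: anti_leibnizator_def bowtie_pure zero_prod_def bil)
  qed (use zero_in_dual in auto)
  also have "\<dots> \<longleftrightarrow> (\<forall>a b. \<forall>\<xi>\<in>D. \<forall>\<eta>\<in>D. double_form (J (0, \<xi>) (a, 0) (b, 0)) (0, \<eta>) = 0 \<and>
      double_form (q (0, \<xi>) (a, 0) - q (a, 0) (0, \<xi>)) (q (b, 0) (0, \<eta>) - q (0, \<eta>) (b, 0)) = 0)"
    by auto
  also have "\<dots> \<longleftrightarrow> anti_leibniz_bialgebra scale m \<Delta>"
    unfolding bialgebra_iff
  proof (intro all_cong1 ball_cong refl)
    fix a b \<xi> \<eta> assume D: "\<xi> \<in> D" "\<eta> \<in> D"
    show "double_form (J (0, \<xi>) (a, 0) (b, 0)) (0, \<eta>) = 0 \<and>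
      double_form (q (0, \<xi>) (a, 0) - q (a, 0) (0, \<xi>)) (q (b, 0) (0, \<eta>) - q (0, \<eta>) (b, 0)) = 0
      \<longleftrightarrow> \<Delta> (m a b) (\<xi>, \<eta>)
      + (\<Delta> a (\<xi>, \<lambda>x. \<eta> (m x b)) - \<Delta> a (\<lambda>x. \<eta> (m x b), \<xi>)
        - (\<Delta> a (\<lambda>x. \<xi> (m x b), \<eta>) - \<Delta> a (\<eta>, \<lambda>x. \<xi> (m x b)))
        + (\<Delta> a (\<lambda>x. \<xi> (m b x), \<eta>) - \<Delta> a (\<eta>, \<lambda>x. \<xi> (m b x))))
      + (\<Delta> b (\<xi>, \<lambda>x. \<eta> (m a x)) + \<Delta> b (\<lambda>x. \<xi> (m a x), \<eta>)) = 0 \<and>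
      \<Delta> b (\<lambda>x. \<xi> (m x a), \<eta>) - \<Delta> a (\<lambda>x. \<eta> (m x b), \<xi>) = 0"
      \<comment> \<open>The left side of the first axiom is minus the value in \<open>J\<close> plus
        the value in \<open>C\<close>. Since \<open>C\<close> vanishes on both sides of the
        equivalence, the two conditions agree.\<close>
      unfolding J[OF D] C[OF D] neg_equal_0_iff_equal
      by (auto simp: algebra_simps)
  qed
  finally show ?thesis by simp
qed

end

theorem theorem2p14:
  fixes scale :: "'k::field_char_0 \<Rightarrow> 'a::ab_group_add \<Rightarrow> 'a"
    and Basis :: "'a set"
    and m :: "'a \<Rightarrow> 'a \<Rightarrow> 'a"
    and \<Delta> :: "'a \<Rightarrow> ('a, 'k) tensor2"
  assumes "finite_dimensional_vector_space scale Basis"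
    and "anti_leibniz_algebra scale UNIV m"
    and "anti_leibniz_coalgebra scale \<Delta>"
  shows "(matched_pair scale UNIV m fun_scale (dual_space scale) (dual_product scale \<Delta>)
            (dual_rep (left_mult m))
            (dual_rep (left_mult m) - dual_rep (right_mult m))
            (codual_rep scale (left_mult (dual_product scale \<Delta>)))
            (codual_rep scale (left_mult (dual_product scale \<Delta>))
              - codual_rep scale (right_mult (dual_product scale \<Delta>)))
          \<longleftrightarrow> (\<exists>p. standard_manin_triple scale m (dual_product scale \<Delta>) p))
       \<and> ((\<exists>p. standard_manin_triple scale m (dual_product scale \<Delta>) p)
          \<longleftrightarrow> anti_leibniz_bialgebra scale m \<Delta>)"
proof -
  interpret finite_dimensional_vector_space scale Basis by (fact assms(1))
  interpret dual_pair scale Basis \<Delta> m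
    using assms(2,3) by unfold_locales (simp_all add: anti_leibniz_coalgebra_def)
  show ?thesis
    using matched_pair_iff_bowtie manin_triple_iff bialgebra_iff_bowtie
    by (simp only: double_scale_eq)
qed

end
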